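(* Let $k$ be a field with $\operatorname{char} k\neq 2$, let $q\in k^\times$ with $q^2\neq 1$, let $C_0$ be an element of the center of $U_q(\mathfrak{sl}_2)$, and let $A$ be the associated quantized symplectic oscillator algebra of rank $1$. Then the set of elements $F^aY^bK^cX^dE^e$, where $a,b,d,e\in\mathbb{Z}_{\ge 0}$ and $c\in\mathbb{Z}$, is a basis of $A$ over $k$.
   Context: $U_q(\mathfrak{sl}_2)$ is the $k$-algebra generated by $E,F,K,K^{-1}$ with $KK^{-1}=K^{-1}K=1$, $KEK^{-1}=q^2E$, $KFK^{-1}=q^{-2}F$, $EF-FE=\frac{K-K^{-1}}{q-q^{-1}}$. For $C_0$ in the center of $U_q(\mathfrak{sl}_2)$, the quantized symplectic oscillator algebra of rank $1$ is the $k$-algebra $A$ generated by $E,F,K,K^{-1},X,Y$ with the relations of $U_q(\mathfrak{sl}_2)$ among $E,F,K^{\pm1}$ together with $EX=qXE$, $EY=X+q^{-1}YE$, $FX=YK^{-1}+XF$, $FY=YF$, $KXK^{-1}=qX$, $KYK^{-1}=q^{-1}Y$, $qYX-XY=C_0$ (where $C_0$ is written in the generators $E,F,K^{\pm1}$). *)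

theory Defs
  imports "HOL-Algebra.QuotRing" "HOL-Library.Poly_Mapping" "Jordan_Normal_Form.VS_Connect"
begin

hide_const (open) Multiset.mult Polynomial.smult Modules.module

section \<open>Free algebras and algebras given by generators and relations\<close>

text \<open>The free monoid on \<open>'g\<close>, written additively so that
  \<open>'g free_monoid \<Rightarrow>\<^sub>0 'k\<close>, with the convolution product of
  \<^theory>\<open>HOL-Library.Poly_Mapping\<close>, is the free associative unital algebra
  \<open>k\<langle>g | g :: 'g\<rangle>\<close> of noncommutative polynomials.\<close>

datatype 'g free_monoid = Word (letters: "'g list")

instantiation free_monoid :: (type) monoid_add
begin

definition zero_free_monoid :: "'a free_monoid"
  where "0 = Word []"

definition plus_free_monoid :: "'a free_monoid \<Rightarrow> 'a free_monoid \<Rightarrow> 'a free_monoid"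
  where "u + v = Word (letters u @ letters v)"

instance
  by standard (simp_all add: zero_free_monoid_def plus_free_monoid_def)

end

type_synonym ('g, 'k) ncpoly = "'g free_monoid \<Rightarrow>\<^sub>0 'k"

definition var :: "'g \<Rightarrow> ('g, 'k::field) ncpoly"
  where "var g = Poly_Mapping.single (Word [g]) 1"

definition scalar :: "'k::field \<Rightarrow> ('g, 'k) ncpoly"
  where "scalar c = Poly_Mapping.single 0 c"

text \<open>The algebra homomorphism of free algebras that renames each generator \<open>g\<close> to \<open>f g\<close>.\<close>

definition rename :: "('g \<Rightarrow> 'h) \<Rightarrow> ('g, 'k::field) ncpoly \<Rightarrow> ('h, 'k) ncpoly"
  where "rename f p =
    (\<Sum>w\<in>Poly_Mapping.keys p. Poly_Mapping.single (map_free_monoid f w) (Poly_Mapping.lookup p w))"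

definition free_algebra :: "('k::field, ('g, 'k) ncpoly) module"
  where "free_algebra =
    \<lparr>carrier = UNIV, mult = (*), one = 1, zero = 0, add = (+), smult = (\<lambda>c p. scalar c * p)\<rparr>"

text \<open>The algebra generated by \<open>'g\<close> subject to \<open>r = 0\<close> for all \<open>r \<in> S\<close>: the quotient of the
  free algebra by the two-sided ideal generated by \<open>S\<close>. The record \<^const>\<open>FactRing\<close> has no
  scalar multiplication, so it is extended by \<open>c (I + p) = I + c p\<close>.\<close>

definition relation_ideal :: "('g, 'k::field) ncpoly set \<Rightarrow> ('g, 'k) ncpoly set"
  where "relation_ideal S = Idl\<^bsub>free_algebra\<^esub> S"

definition presented_algebra ::
    "('g, 'k::field) ncpoly set \<Rightarrow> ('k, ('g, 'k) ncpoly set) module"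
  where "presented_algebra S = ring.extend (free_algebra Quot relation_ideal S)
    (module.fields (\<lambda>c P. \<Union>p\<in>P. relation_ideal S +>\<^bsub>free_algebra\<^esub> (c \<odot>\<^bsub>free_algebra\<^esub> p)))"

definition coset_of :: "('g, 'k::field) ncpoly set \<Rightarrow> ('g, 'k) ncpoly \<Rightarrow> ('g, 'k) ncpoly set"
  where "coset_of S p = relation_ideal S +>\<^bsub>free_algebra\<^esub> p"

definition center :: "('a, 'm) ring_scheme \<Rightarrow> 'a set"
  where "center R = {z \<in> carrier R. \<forall>x\<in>carrier R. z \<otimes>\<^bsub>R\<^esub> x = x \<otimes>\<^bsub>R\<^esub> z}"

lemma free_algebra_sel [simp]:
  "carrier free_algebra = UNIV" "p \<otimes>\<^bsub>free_algebra\<^esub> r = p * r" "\<one>\<^bsub>free_algebra\<^esub> = 1"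
  "\<zero>\<^bsub>free_algebra\<^esub> = 0" "p \<oplus>\<^bsub>free_algebra\<^esub> r = p + r" "c \<odot>\<^bsub>free_algebra\<^esub> p = scalar c * p"
  by (simp_all add: free_algebra_def)

lemma ring_free_algebra: "ring free_algebra"
proof (rule ringI)
  show "abelian_group (free_algebra :: ('k::field, ('g, 'k) ncpoly) module)"
  proof (rule abelian_groupI)
    fix x :: "('g, 'k) ncpoly"
    show "\<exists>y\<in>carrier free_algebra. y \<oplus>\<^bsub>free_algebra\<^esub> x = \<zero>\<^bsub>free_algebra\<^esub>"
      by (rule bexI[of _ "- x"]) simp_all
  qed (simp_all add: ac_simps)
  show "Group.monoid (free_algebra :: ('k::field, ('g, 'k) ncpoly) module)"
    by (rule monoidI) (simp_all add: mult.assoc)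
qed (simp_all add: distrib_left distrib_right)

lemma ideal_relation_ideal: "ideal (relation_ideal S) free_algebra"
  unfolding relation_ideal_def by (rule ring.genideal_ideal[OF ring_free_algebra]) simp

lemma presented_algebra_sel:
  "carrier (presented_algebra S) = range (coset_of S)"
  "\<one>\<^bsub>presented_algebra S\<^esub> = coset_of S 1"
  "\<zero>\<^bsub>presented_algebra S\<^esub> = coset_of S 0"
  "coset_of S p \<otimes>\<^bsub>presented_algebra S\<^esub> coset_of S r = coset_of S (p * r)"
  "coset_of S p \<oplus>\<^bsub>presented_algebra S\<^esub> coset_of S r = coset_of S (p + r)"
  "c \<odot>\<^bsub>presented_algebra S\<^esub> coset_of S p = coset_of S (scalar c * p)"
proof -
  interpret ideal "relation_ideal S" free_algebra by (rule ideal_relation_ideal)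
  have eq: "coset_of S p = coset_of S r" if "p - r \<in> relation_ideal S" for p r
  proof -
    have "p \<in> relation_ideal S +>\<^bsub>free_algebra\<^esub> r"
      using that by (force simp: a_r_coset_def r_coset_def)
    then show ?thesis
      unfolding coset_of_def using a_repr_independence'[of p r] by simp
  qed
  show "carrier (presented_algebra S) = range (coset_of S)"
    by (auto simp: presented_algebra_def ring.defs FactRing_def A_RCOSETS_defs a_r_coset_def
        coset_of_def)
  show "\<one>\<^bsub>presented_algebra S\<^esub> = coset_of S 1"
    by (simp add: presented_algebra_def ring.defs FactRing_def coset_of_def)
  show "\<zero>\<^bsub>presented_algebra S\<^esub> = coset_of S 0"
    by (simp add: presented_algebra_def ring.defs FactRing_def coset_of_def a_r_coset_def
        r_coset_def)
  show "coset_of S p \<otimes>\<^bsub>presented_algebra S\<^esub> coset_of S r = coset_of S (p * r)"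
    using rcoset_mult_add[of p r]
    by (simp add: presented_algebra_def ring.defs FactRing_def coset_of_def)
  show "coset_of S p \<oplus>\<^bsub>presented_algebra S\<^esub> coset_of S r = coset_of S (p + r)"
    using a_rcos_sum[of p r]
    by (simp add: presented_algebra_def ring.defs FactRing_def coset_of_def)
  have "coset_of S (scalar c * r) = coset_of S (scalar c * p)" if "r \<in> coset_of S p" for r
  proof (rule eq)
    obtain h where "h \<in> relation_ideal S" "r = h + p"
      using \<open>r \<in> coset_of S p\<close> by (auto simp: coset_of_def a_r_coset_def r_coset_def)
    then show "scalar c * r - scalar c * p \<in> relation_ideal S"
      using I_l_closed[of h "scalar c"] by (simp add: algebra_simps)
  qed
  moreover have "p \<in> coset_of S p"
    unfolding coset_of_def using a_rcos_self[of p] by simp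
  ultimately have "(\<Union>r\<in>coset_of S p. coset_of S (scalar c * r)) = coset_of S (scalar c * p)"
    by blast
  then show "c \<odot>\<^bsub>presented_algebra S\<^esub> coset_of S p = coset_of S (scalar c * p)"
    by (simp add: presented_algebra_def ring.defs module.defs coset_of_def)
qed

lemma scalar_add: "scalar (a + b) = scalar a + scalar b"
  and scalar_mult: "scalar (a * b) = scalar a * scalar b"
  and scalar_one [simp]: "scalar 1 = 1"
  and scalar_commute: "scalar a * p = p * scalar a"
proof -
  show "scalar a * p = p * scalar a"
  proof (induction p rule: Poly_Mapping.update_induct)
    case (update p w c)
    have "Poly_Mapping.update w c p = p + Poly_Mapping.single w c"
      using update(1)
      by (intro poly_mapping_eqI)
        (auto simp: lookup_update lookup_add lookup_single in_keys_iff when_def)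
    moreover have "scalar a * Poly_Mapping.single w c = Poly_Mapping.single w c * scalar a"
      by (simp add: scalar_def mult_single mult.commute)
    ultimately show ?case
      using update(3) by (simp only: distrib_left distrib_right)
  qed simp
qed (simp_all add: scalar_def single_add mult_single)

lemma ring_presented_algebra: "ring (presented_algebra S)"
proof (rule ringI)
  show "abelian_group (presented_algebra S)"
  proof (rule abelian_groupI)
    fix x assume "x \<in> carrier (presented_algebra S)"
    then obtain p where "x = coset_of S p" by (auto simp: presented_algebra_sel)
    then show "\<exists>y\<in>carrier (presented_algebra S).
        y \<oplus>\<^bsub>presented_algebra S\<^esub> x = \<zero>\<^bsub>presented_algebra S\<^esub>"
      by (intro bexI[of _ "coset_of S (- p)"]) (simp_all add: presented_algebra_sel)
  qed (auto simp: presented_algebra_sel ac_simps)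
  show "Group.monoid (presented_algebra S)"
    by (rule monoidI) (auto simp: presented_algebra_sel mult.assoc)
qed (auto simp: presented_algebra_sel distrib_left distrib_right)

lemma vectorspace_presented_algebra:
  "vectorspace (class_ring :: 'k::field ring) (presented_algebra (S :: ('g, 'k) ncpoly set))"
proof -
  have "cring (class_ring :: 'k ring)" "field (class_ring :: 'k ring)"
    using class_field.field_axioms by (auto simp: field_def domain_def)
  moreover have "module (class_ring :: 'k ring) (presented_algebra S)"
    by (rule moduleI)
      (use \<open>cring class_ring\<close> in \<open>auto simp: presented_algebra_sel ring.is_abelian_group
         ring_presented_algebra scalar_add scalar_mult algebra_simps\<close>)
  ultimately show ?thesis by (simp add: vectorspace_def)
qed


section \<open>The algebra $U_q(\mathfrak{sl}_2)$\<close>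

text \<open>\<open>K'\<close> is the generator $K^{-1}$.\<close>

datatype uq_gen = E | F | K | K'

definition uq_relators :: "'k::field \<Rightarrow> (uq_gen, 'k) ncpoly set"
  where "uq_relators q =
   {var K * var K' - 1,
    var K' * var K - 1,
    var K * var E * var K' - scalar (q\<^sup>2) * var E,
    var K * var F * var K' - scalar (inverse (q\<^sup>2)) * var F,
    var E * var F - var F * var E - scalar (1 / (q - inverse q)) * (var K - var K')}"

definition uq_sl2 :: "'k::field \<Rightarrow> ('k, (uq_gen, 'k) ncpoly set) module"
  where "uq_sl2 q = presented_algebra (uq_relators q)"


section \<open>The quantized symplectic oscillator algebra of rank 1\<close>

datatype osc_gen = U uq_gen | X | Y

text \<open>Here \<open>c0\<close> is a noncommutative polynomial in \<open>E\<close>, \<open>F\<close>, \<open>K\<close>, \<open>K'\<close>. The intended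
  \<open>c0\<close> are representatives of a central element \<open>C0\<close> of \<^const>\<open>uq_sl2\<close>; since the relators of
  \<^const>\<open>uq_sl2\<close> are among those below, the algebra does not depend on the representative.\<close>

definition osc_relators :: "'k::field \<Rightarrow> (uq_gen, 'k) ncpoly \<Rightarrow> (osc_gen, 'k) ncpoly set"
  where "osc_relators q c0 =
   rename U ` uq_relators q \<union>
   {var (U E) * var X - scalar q * var X * var (U E),
    var (U E) * var Y - (var X + scalar (inverse q) * var Y * var (U E)),
    var (U F) * var X - (var Y * var (U K') + var X * var (U F)),
    var (U F) * var Y - var Y * var (U F),
    var (U K) * var X * var (U K') - scalar q * var X,
    var (U K) * var Y * var (U K') - scalar (inverse q) * var Y,
    scalar q * var Y * var X - var X * var Y - rename U c0}"

definition osc_algebra ::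
    "'k::field \<Rightarrow> (uq_gen, 'k) ncpoly \<Rightarrow> ('k, (osc_gen, 'k) ncpoly set) module"
  where "osc_algebra q c0 = presented_algebra (osc_relators q c0)"

definition osc_elem ::
    "'k::field \<Rightarrow> (uq_gen, 'k) ncpoly \<Rightarrow> osc_gen \<Rightarrow> (osc_gen, 'k) ncpoly set"
  where "osc_elem q c0 g = coset_of (osc_relators q c0) (var g)"

text \<open>$F^a Y^b K^c X^d E^e$ in the algebra. For $c < 0$, the integer power of HOL-Algebra is formed
  with the inverse of \<open>K\<close>, which is the class of \<open>K'\<close>.\<close>

definition pbw_monomial ::
    "'k::field \<Rightarrow> (uq_gen, 'k) ncpoly \<Rightarrow> nat \<times> nat \<times> int \<times> nat \<times> nat \<Rightarrow> (osc_gen, 'k) ncpoly set"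
  where "pbw_monomial q c0 = (\<lambda>(a, b, c, d, e).
    let A = osc_algebra q c0; x = osc_elem q c0 in
      x (U F) [^]\<^bsub>A\<^esub> a \<otimes>\<^bsub>A\<^esub> x Y [^]\<^bsub>A\<^esub> b \<otimes>\<^bsub>A\<^esub> x (U K) [^]\<^bsub>A\<^esub> c \<otimes>\<^bsub>A\<^esub> x X [^]\<^bsub>A\<^esub> d \<otimes>\<^bsub>A\<^esub> x (U E) [^]\<^bsub>A\<^esub> e)"

end

theory Submission
  imports Defs
begin

text \<open>
  The defining relations rewrite every word in the generators so that \<open>F\<close> precedes \<open>Y\<close>, \<open>Y\<close> precedes
  the powers of \<open>K\<close>, these precede \<open>X\<close>, and \<open>X\<close> precedes \<open>E\<close>. The content of the theorem is that the
  normal forms obtained in this way satisfy no linear relation. Instead of resolving overlaps of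
  rewriting rules, the proof constructs the regular representation: on the vector space \<open>V\<close> with a
  basis vector for each monomial $F^a Y^b K^c X^d E^e$ there are operators for the generators,
  given by what left multiplication must do to a monomial, and these operators satisfy the
  defining relations.

  \<^bold>\<open>Construction.\<close> \<open>F\<close> and \<open>Y\<close> act by shifting an exponent, and \<open>K\<close> by a shift with a power of \<open>q\<close>.
  The relations for $EF$, $EY$ and $XF$ say how \<open>E\<close> acts on a monomial with \<open>F\<close> or \<open>Y\<close> in front, and
  \<open>X\<close> on one with \<open>F\<close> in front, once the action on the rest of the monomial is known. The relation
  $XY = qYX - C_0$ is the delicate one, since $C_0$ is an arbitrary expression in \<open>E\<close>, \<open>F\<close>, \<open>K\<close>, and
  \<open>E\<close> itself depends on \<open>X\<close> through $EY = X + q^{-1}YE$. The circle is broken by the filtration of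
  \<open>V\<close> by the exponent \<open>b\<close> of \<open>Y\<close>: the operators \<open>E\<close>, \<open>F\<close>, \<open>K\<close> preserve it, and on the part with
  exponent at most \<open>b\<close> they only involve the values of \<open>X\<close> on monomials $Y^m K^c X^d E^e$ with
  $m < b$. Hence these values (\<open>X_seed\<close>) can be defined by recursion on \<open>m\<close> (\<open>X_seed_Suc\<close>).

  \<^bold>\<open>Verification.\<close> The relations for $EF$, $XF$ and $EY$ follow from the definitions. The
  relations of \<open>K\<close> with \<open>E\<close> and \<open>X\<close> are shown by induction along the filtration: if they hold up to
  exponent \<open>n\<close>, then the part of \<open>V\<close> with exponent at most \<open>n\<close> is a module over
  $U_q(\mathfrak{sl}_2)$, so $C_0$, being central, commutes there with \<open>E\<close>, \<open>F\<close>, \<open>K\<close>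
  (\<open>opC_commute\<close>); this gives the relation for $XY$ up to \<open>n\<close>, and then the two relations
  of \<open>K\<close> up to $n + 1$ (\<open>K_E_K_X_filt\<close>). Finally $EX = qXE$ follows by induction on monomials.

  \<^bold>\<open>Conclusion.\<close> Let \<open>1\<close> denote the basis vector of the empty monomial. A monomial applied to \<open>1\<close>
  gives its own basis vector (\<open>act_monomial\<close>), which proves linear independence. For the spanning
  property let \<open>\<phi>\<close> be the linear map from \<open>V\<close> to the algebra that sends each basis vector to its
  monomial. It carries the operators to left multiplication (\<open>intertwined_osc_op\<close>), since the
  operators were defined by relations that hold in the algebra; therefore every element \<open>p\<close> of the
  algebra is the image under \<open>\<phi>\<close> of the vector \<open>p \<cdot> 1\<close> (\<open>cl_to_free_act\<close>).
\<close>

section \<open>Finitely supported functions as vectors\<close>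

definition scale :: "'k::field \<Rightarrow> ('i \<Rightarrow>\<^sub>0 'k) \<Rightarrow> ('i \<Rightarrow>\<^sub>0 'k)"  (infixr "*\<^sub>p" 75)
  where "c *\<^sub>p v = Poly_Mapping.map ((*) c) v"

abbreviation basis_vector :: "'i \<Rightarrow> ('i \<Rightarrow>\<^sub>0 'k::field)"
  where "basis_vector i \<equiv> Poly_Mapping.single i 1"

lemma lookup_scale [simp]: "Poly_Mapping.lookup (c *\<^sub>p v) i = c * Poly_Mapping.lookup v i"
  by (simp add: scale_def Poly_Mapping.map.rep_eq when_def)

lemma scale_simps [simp]:
  "c *\<^sub>p (0 :: 'i \<Rightarrow>\<^sub>0 'k::field) = 0" "0 *\<^sub>p v = 0" "1 *\<^sub>p v = v" "c *\<^sub>p d *\<^sub>p v = (c * d) *\<^sub>p v"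
  by (rule poly_mapping_eqI; simp)+

lemma scale_add: "c *\<^sub>p (u + v) = c *\<^sub>p u + c *\<^sub>p v"
  by (rule poly_mapping_eqI) (simp add: lookup_add algebra_simps)

lemma scale_add_left: "(c + d) *\<^sub>p v = c *\<^sub>p v + d *\<^sub>p v"
  by (rule poly_mapping_eqI) (simp add: lookup_add algebra_simps)

lemma scale_diff: "c *\<^sub>p (u - v) = c *\<^sub>p u - c *\<^sub>p v"
  by (rule poly_mapping_eqI) (simp add: lookup_minus algebra_simps)

lemma scale_sum: "c *\<^sub>p sum f A = (\<Sum>i\<in>A. c *\<^sub>p f i)"
  by (rule poly_mapping_eqI) (simp add: lookup_sum sum_distrib_left)

lemma scale_single: "c *\<^sub>p Poly_Mapping.single i a = Poly_Mapping.single i (c * a)"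
  by (rule poly_mapping_eqI) (simp add: lookup_single when_def)

lemma keys_scale: "Poly_Mapping.keys (c *\<^sub>p v) \<subseteq> Poly_Mapping.keys v"
  by (auto simp: in_keys_iff)

text \<open>A form of induction that also suits statements about products and scalar multiples, where the
  coefficient is better kept inside the monomial.\<close>

lemma add_single_induct [consumes 1, case_names zero add single]:
  fixes v :: "'i \<Rightarrow>\<^sub>0 'k::field"
  assumes "Poly_Mapping.keys v \<subseteq> S"
    and "P 0"
    and "\<And>u v. P u \<Longrightarrow> P v \<Longrightarrow> P (u + v)"
    and "\<And>i c. i \<in> S \<Longrightarrow> P (Poly_Mapping.single i c)"
  shows "P v"
proof -
  have "v = (\<Sum>i\<in>Poly_Mapping.keys v. Poly_Mapping.single i (Poly_Mapping.lookup v i))"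
    by (rule poly_mapping_eqI)
      (simp add: lookup_sum lookup_single when_def in_keys_iff cong: if_cong)
  moreover have "P (\<Sum>i\<in>A. Poly_Mapping.single i (Poly_Mapping.lookup v i))"
    if "finite A" "A \<subseteq> S" for A
    using that by (induction A) (auto intro!: assms)
  ultimately show ?thesis
    using assms(1) by (metis finite_keys)
qed

lemma vector_induct [consumes 1, case_names zero add scale unit]:
  fixes v :: "'i \<Rightarrow>\<^sub>0 'k::field"
  assumes "Poly_Mapping.keys v \<subseteq> S"
    and "P 0"
    and "\<And>u v. P u \<Longrightarrow> P v \<Longrightarrow> P (u + v)"
    and "\<And>c u. P u \<Longrightarrow> P (c *\<^sub>p u)"
    and "\<And>i. i \<in> S \<Longrightarrow> P (basis_vector i)"
  shows "P v"
  using assms(1)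
proof (induction rule: add_single_induct)
  case (single i c)
  then show ?case
    using assms(4)[OF assms(5), of i c] by (simp add: scale_single)
qed (use assms in auto)

definition linear_ext :: "('i \<Rightarrow> ('j \<Rightarrow>\<^sub>0 'k)) \<Rightarrow> ('i \<Rightarrow>\<^sub>0 'k::field) \<Rightarrow> ('j \<Rightarrow>\<^sub>0 'k)"
  where "linear_ext g v = (\<Sum>i\<in>Poly_Mapping.keys v. Poly_Mapping.lookup v i *\<^sub>p g i)"

lemma linear_ext_superset:
  assumes "finite A" "Poly_Mapping.keys v \<subseteq> A"
  shows "linear_ext g v = (\<Sum>i\<in>A. Poly_Mapping.lookup v i *\<^sub>p g i)"
  unfolding linear_ext_def
  by (rule sum.mono_neutral_left) (use assms in \<open>auto simp: in_keys_iff\<close>)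

lemma linear_ext_add [simp]: "linear_ext g (u + v) = linear_ext g u + linear_ext g v"
proof -
  let ?A = "Poly_Mapping.keys u \<union> Poly_Mapping.keys v"
  have "linear_ext g w = (\<Sum>i\<in>?A. Poly_Mapping.lookup w i *\<^sub>p g i)" if "w \<in> {u, v, u + v}" for w
    using that by (intro linear_ext_superset) (auto dest: subsetD[OF keys_add])
  then show ?thesis
    by (simp add: lookup_add scale_add_left sum.distrib)
qed

lemma linear_ext_scale [simp]: "linear_ext g (c *\<^sub>p v) = c *\<^sub>p linear_ext g v"
proof -
  have "linear_ext g (c *\<^sub>p v)
    = (\<Sum>i\<in>Poly_Mapping.keys v. Poly_Mapping.lookup (c *\<^sub>p v) i *\<^sub>p g i)"
    by (rule linear_ext_superset) (auto simp: keys_scale)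
  then show ?thesis
    by (simp add: linear_ext_def scale_sum)
qed

lemma linear_ext_zero [simp]: "linear_ext g 0 = 0"
  by (simp add: linear_ext_def)

lemma linear_ext_diff [simp]: "linear_ext g (u - v) = linear_ext g u - linear_ext g v"
  by (metis linear_ext_add add_diff_cancel_right' diff_add_cancel)

lemma linear_ext_single [simp]: "linear_ext g (Poly_Mapping.single i c) = c *\<^sub>p g i"
  by (simp add: linear_ext_superset[of "{i}"])

lemma linear_ext_cong:
  "(\<And>i. i \<in> Poly_Mapping.keys v \<Longrightarrow> g i = h i) \<Longrightarrow> linear_ext g v = linear_ext h v"
  by (simp add: linear_ext_def)

definition linear_op :: "(('i \<Rightarrow>\<^sub>0 'k) \<Rightarrow> ('j \<Rightarrow>\<^sub>0 'k::field)) \<Rightarrow> bool"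
  where "linear_op T \<longleftrightarrow> (\<forall>u v. T (u + v) = T u + T v) \<and> (\<forall>c v. T (c *\<^sub>p v) = c *\<^sub>p T v)"

lemma linear_op_zero: "linear_op T \<Longrightarrow> T 0 = 0"
  by (metis linear_op_def scale_simps(2))

lemma linear_op_linear_ext [simp]: "linear_op (linear_ext g)"
  by (simp add: linear_op_def)

section \<open>Representations of free algebras and of their quotients\<close>

text \<open>The extension to noncommutative polynomials of an assignment of operators to the generators; it is
  a representation of the free algebra when these operators are linear.\<close>

definition act ::
    "('g \<Rightarrow> ('i \<Rightarrow>\<^sub>0 'k) \<Rightarrow> ('i \<Rightarrow>\<^sub>0 'k)) \<Rightarrow> ('g, 'k::field) ncpoly \<Rightarrow> ('i \<Rightarrow>\<^sub>0 'k) \<Rightarrow> ('i \<Rightarrow>\<^sub>0 'k)"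
  where "act T p v = linear_ext (\<lambda>w. foldr T (letters w) v) p"

lemma act_simps [simp]:
  "act T (p + r) v = act T p v + act T r v" "act T (p - r) v = act T p v - act T r v"
  "act T 0 v = 0" "act T (c *\<^sub>p p) v = c *\<^sub>p act T p v" "act T 1 v = v"
  "act T (var g) v = T g v" "act T (scalar c) v = c *\<^sub>p v"
  by (simp_all add: act_def var_def scalar_def zero_free_monoid_def flip: single_one)

lemma scalar_eq_scale: "scalar c * p = c *\<^sub>p p"
proof -
  have "Poly_Mapping.keys p \<subseteq> UNIV"
    by simp
  then show ?thesis
    by (induction rule: add_single_induct)
      (simp_all add: distrib_left scale_add scalar_def mult_single scale_single)
qed

lemma linear_op_act:
  assumes "\<And>g. linear_op (T g)"
  shows "linear_op (act T p)"
proof -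
  have "linear_op (\<lambda>v. foldr T ws v)" for ws
    by (induction ws) (use assms in \<open>auto simp: linear_op_def\<close>)
  then show ?thesis
    unfolding linear_op_def act_def linear_ext_def
    by (simp add: scale_add sum.distrib scale_sum mult.commute)
qed

lemma act_mult:
  assumes "\<And>g. linear_op (T g)"
  shows "act T (p * r) v = act T p (act T r v)"
proof -
  have add: "act T p (u + v) = act T p u + act T p v"
    and scale: "act T p (c *\<^sub>p v) = c *\<^sub>p act T p v" for p c u v
    using linear_op_act[of T p, OF assms] by (simp_all add: linear_op_def)
  have zero: "act T p 0 = 0" for p
    using linear_op_zero[OF linear_op_act[OF assms]] .
  have "Poly_Mapping.keys p \<subseteq> UNIV" "Poly_Mapping.keys r \<subseteq> UNIV"
    by auto
  then show ?thesis
  proof (induction p rule: add_single_induct)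
    case (single x a)
    from single(2) show ?case
    proof (induction r rule: add_single_induct)
      case (single y b)
      have "act T (Poly_Mapping.single z c) u = c *\<^sub>p foldr T (letters z) u" for z c u
        by (simp add: act_def)
      then show ?case
        using scale[of "Poly_Mapping.single x 1" b "foldr T (letters y) v"]
        by (simp add: mult_single plus_free_monoid_def)
    qed (simp_all add: distrib_left add zero)
  qed (simp_all add: distrib_right)
qed

lemma keys_act:
  assumes "\<And>g v. Poly_Mapping.keys v \<subseteq> J \<Longrightarrow> Poly_Mapping.keys (T g v) \<subseteq> J"
    and "Poly_Mapping.keys v \<subseteq> J"
  shows "Poly_Mapping.keys (act T p v) \<subseteq> J"
proof -
  have word: "Poly_Mapping.keys (foldr T ws v) \<subseteq> J" for ws
    by (induction ws) (simp_all add: assms)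
  have "Poly_Mapping.keys p \<subseteq> UNIV"
    by simp
  then show ?thesis
    by (induction p rule: add_single_induct)
      (use word in \<open>auto simp: act_def dest!: subsetD[OF keys_add] subsetD[OF keys_scale]\<close>)
qed

text \<open>The polynomials that annihilate an invariant subspace form a two-sided ideal. The subspace is allowed
  to be proper because the relations are first known on the pieces of a filtration; subspaces
  spanned by basis vectors suffice for this.\<close>

lemma relation_ideal_acts_by_zero:
  fixes T :: "'g \<Rightarrow> ('i \<Rightarrow>\<^sub>0 'k::field) \<Rightarrow> ('i \<Rightarrow>\<^sub>0 'k)"
  assumes lin: "\<And>g. linear_op (T g)"
    and inv: "\<And>g v. Poly_Mapping.keys v \<subseteq> J \<Longrightarrow> Poly_Mapping.keys (T g v) \<subseteq> J"
    and rel: "\<And>r v. r \<in> S \<Longrightarrow> Poly_Mapping.keys v \<subseteq> J \<Longrightarrow> act T r v = 0"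
    and "p \<in> relation_ideal S" "Poly_Mapping.keys v \<subseteq> J"
  shows "act T p v = 0"
proof -
  let ?I = "{p. \<forall>v. Poly_Mapping.keys v \<subseteq> J \<longrightarrow> act T p v = 0}"
  have "ideal ?I free_algebra"
  proof (rule idealI)
    show "ring (free_algebra :: ('k, ('g, 'k) ncpoly) module)"
      by (rule ring_free_algebra)
    show "subgroup ?I (add_monoid (free_algebra :: ('k, ('g, 'k) ncpoly) module))"
    proof (rule group.subgroupI)
      show "Group.group (add_monoid (free_algebra :: ('k, ('g, 'k) ncpoly) module))"
        using ring_free_algebra abelian_group.a_group ring.is_abelian_group by blast
      fix a :: "('g, 'k) ncpoly" assume a: "a \<in> ?I"
      have "inv\<^bsub>add_monoid free_algebra\<^esub> a = - a"
        using abelian_group.minus_equality[OF ring.is_abelian_group[OF ring_free_algebra], of "- a" a]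
        by (simp add: a_inv_def)
      moreover have "act T (- a) v = - act T a v" for v
        using act_simps(2)[of T 0 a v] by simp
      ultimately show "inv\<^bsub>add_monoid free_algebra\<^esub> a \<in> ?I"
        using a by simp
    qed (auto intro: exI[of _ 0])
  qed (auto simp: act_mult[OF lin] keys_act[OF inv] linear_op_zero[OF linear_op_act[OF lin]])
  then have "relation_ideal S \<subseteq> ?I"
    unfolding relation_ideal_def
    by (rule ring.genideal_minimal[OF ring_free_algebra]) (use rel in auto)
  then show ?thesis
    using assms(4,5) by blast
qed

lemma rename_eq_linear_ext: "rename f = linear_ext (\<lambda>w. basis_vector (map_free_monoid f w))"
  by (rule ext) (simp add: rename_def linear_ext_def scale_single)

lemma act_rename: "act T (rename f p) v = act (\<lambda>g. T (f g)) p v"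
proof -
  have letters: "letters (map_free_monoid f w) = map f (letters w)" for w
    by (cases w) simp
  have "Poly_Mapping.keys p \<subseteq> UNIV"
    by simp
  then show ?thesis
    by (induction p rule: add_single_induct)
      (simp_all add: rename_eq_linear_ext act_def foldr_map scale_single o_def letters)
qed

lemma rename_mult: "rename f (p * r) = rename f p * rename f r"
proof -
  have plus: "map_free_monoid f (x + y) = map_free_monoid f x + map_free_monoid f y" for x y
    by (cases x; cases y) (simp add: plus_free_monoid_def)
  have "Poly_Mapping.keys p \<subseteq> UNIV" "Poly_Mapping.keys r \<subseteq> UNIV"
    by auto
  then show ?thesis
  proof (induction p rule: add_single_induct)
    case (single x a)
    from single(2) show ?case
      by (induction r rule: add_single_induct)
        (simp_all add: rename_eq_linear_ext mult_single plus distrib_left scale_single)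
  qed (simp_all add: rename_eq_linear_ext distrib_right)
qed

lemma rename_simps [simp]:
  "rename f (p + r) = rename f p + rename f r" "rename f (p - r) = rename f p - rename f r"
  "rename f (c *\<^sub>p p) = c *\<^sub>p rename f p" "rename f 1 = 1" "rename f (var g) = var (f g)"
  "rename f (scalar c) = scalar c"
  by (simp_all add: rename_eq_linear_ext var_def scalar_def scale_single zero_free_monoid_def
      flip: single_one)

section \<open>Cosets of a relation ideal\<close>

lemma coset_of_eq_iff: "coset_of S p = coset_of S s \<longleftrightarrow> p - s \<in> relation_ideal S"
proof -
  interpret ideal "relation_ideal S" free_algebra by (rule ideal_relation_ideal)
  have "p \<in> relation_ideal S +>\<^bsub>free_algebra\<^esub> s \<longleftrightarrow> p - s \<in> relation_ideal S"
    by (force simp: a_r_coset_def r_coset_def)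
  then show ?thesis
    unfolding coset_of_def
    using a_repr_independence'[of p s] a_rcos_self[of p] by auto
qed

lemma coset_of_relator: "p - s \<in> S \<Longrightarrow> coset_of S p = coset_of S s"
  unfolding coset_of_eq_iff relation_ideal_def
  using ring.genideal_self[OF ring_free_algebra, of S] by auto

lemma coset_of_cong:
  assumes "coset_of S p = coset_of S p'"
  shows "coset_of S (t * p) = coset_of S (t * p')" "coset_of S (p * t) = coset_of S (p' * t)"
    "coset_of S (c *\<^sub>p p) = coset_of S (c *\<^sub>p p')"
  using assms by (metis presented_algebra_sel(4), metis presented_algebra_sel(4),
    metis presented_algebra_sel(6) scalar_eq_scale)

lemma coset_of_cong_add:
  assumes "coset_of S p = coset_of S p'" "coset_of S s = coset_of S s'"
  shows "coset_of S (p + s) = coset_of S (p' + s')"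
  using assms by (metis presented_algebra_sel(5))

lemma coset_of_cong_diff:
  assumes "coset_of S p = coset_of S p'" "coset_of S s = coset_of S s'"
  shows "coset_of S (p - s) = coset_of S (p' - s')"
  using coset_of_cong_add[OF assms(1) coset_of_cong(3)[OF assms(2), of "-1"]]
  by (simp add: flip: scalar_eq_scale) (simp add: scalar_def single_uminus)

lemma scale_mult [simp]:
  fixes p :: "('g, 'k::field) ncpoly"
  shows "(c *\<^sub>p p) * s = c *\<^sub>p (p * s)" "p * (c *\<^sub>p s) = c *\<^sub>p (p * s)"
  by (simp_all add: mult.assoc flip: scalar_eq_scale)
    (metis mult.assoc scalar_commute)

lemma finsum_coset_of:
  "finite J \<Longrightarrow> (\<Oplus>\<^bsub>presented_algebra S\<^esub>i\<in>J. coset_of S (f i)) = coset_of S (sum f J)"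
proof (induction J rule: finite_induct)
  case empty
  interpret ring "presented_algebra S" by (rule ring_presented_algebra)
  show ?case by (simp add: presented_algebra_sel)
next
  case (insert j J)
  interpret ring "presented_algebra S" by (rule ring_presented_algebra)
  have "coset_of S p \<in> carrier (presented_algebra S)" for p
    by (simp add: presented_algebra_sel)
  then show ?case
    using insert by (simp add: presented_algebra_sel)
qed

text \<open>If \<open>m\<close> extends to a linear bijection from a space of finitely supported functions onto the
  algebra, then it carries the standard basis to a basis. This isolates the passage from the
  HOL-Algebra notion of a basis to that bijection.\<close>

lemma basis_of_linear_bijection:
  fixes m :: "'i \<Rightarrow> ('g, 'k::field) ncpoly"
  assumes inj: "\<And>v. coset_of S (linear_ext m v) = coset_of S 0 \<Longrightarrow> v = 0"
    and surj: "\<And>p. \<exists>v. coset_of S p = coset_of S (linear_ext m v)"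
  shows "Fun.inj (\<lambda>i. coset_of S (m i)) \<and>
    vectorspace.basis class_ring (presented_algebra S) (range (\<lambda>i. coset_of S (m i)))"
proof -
  let ?b = "\<lambda>i. coset_of S (m i)"
  interpret V: vectorspace "class_ring :: 'k ring" "presented_algebra S"
    by (rule vectorspace_presented_algebra)
  have carrier: "coset_of S p \<in> carrier (presented_algebra S)" for p
    by (simp add: presented_algebra_sel)
  have inj_b: "Fun.inj ?b"
  proof (rule injI)
    fix i j assume "?b i = ?b j"
    then have "coset_of S (linear_ext m (basis_vector i - basis_vector j)) = coset_of S 0"
      using coset_of_cong_diff[of S "m i" "m j" "m j" "m j"] by simp
    then have "basis_vector i = (basis_vector j :: 'i \<Rightarrow>\<^sub>0 'k)"
      using inj[of "basis_vector i - basis_vector j"] by simp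
    then have "Poly_Mapping.keys (basis_vector i :: 'i \<Rightarrow>\<^sub>0 'k) = Poly_Mapping.keys (basis_vector j :: 'i \<Rightarrow>\<^sub>0 'k)"
      by simp
    then show "i = j"
      by simp
  qed
  have lincomb: "V.lincomb a (?b ` J)
      = coset_of S (linear_ext m (\<Sum>i\<in>J. Poly_Mapping.single i (a (?b i))))"
    if "finite J" for a J
  proof -
    have "V.lincomb a (?b ` J) = (\<Oplus>\<^bsub>presented_algebra S\<^esub>i\<in>J. a (?b i) \<odot>\<^bsub>presented_algebra S\<^esub> ?b i)"
      unfolding V.lincomb_def
      by (rule V.finsum_reindex)
        (use inj_b carrier in \<open>auto simp: presented_algebra_sel inj_on_def\<close>)
    also have "\<dots> = coset_of S (\<Sum>i\<in>J. a (?b i) *\<^sub>p m i)"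
      using that by (simp add: presented_algebra_sel finsum_coset_of scalar_eq_scale)
    also have "(\<Sum>i\<in>J. a (?b i) *\<^sub>p m i) = linear_ext m (\<Sum>i\<in>J. Poly_Mapping.single i (a (?b i)))"
      using that by (induction J) simp_all
    finally show ?thesis .
  qed
  have lookup: "Poly_Mapping.lookup (\<Sum>i\<in>J. Poly_Mapping.single i (c i)) j = (if j \<in> J then c j else 0)"
    if "finite J" for J c j
    using that by (simp add: lookup_sum lookup_single when_def)
  have "V.lin_indpt (range ?b)"
    unfolding V.lin_dep_def
  proof (rule notI, elim exE conjE)
    fix A a x
    assume A: "finite A" "A \<subseteq> range ?b" "x \<in> A"
      and zero: "V.lincomb a A = \<zero>\<^bsub>presented_algebra S\<^esub>" and "a x \<noteq> \<zero>\<^bsub>class_ring\<^esub>"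
    then obtain j where x: "x = ?b j" and ne: "a (?b j) \<noteq> \<zero>\<^bsub>class_ring\<^esub>"
      by blast
    define J where "J = ?b -` A"
    have J: "finite J" "A = ?b ` J" "j \<in> J"
      using A x finite_vimageI[OF A(1) inj_b] by (auto simp: J_def)
    then have "(\<Sum>i\<in>J. Poly_Mapping.single i (a (?b i))) = 0"
      using lincomb[of J a] zero inj by (simp add: presented_algebra_sel)
    then show False
      using lookup[of J "\<lambda>i. a (?b i)" j] J ne by simp
  qed
  moreover have "V.gen_set (range ?b)"
  proof
    show "V.span (range ?b) \<subseteq> carrier (presented_algebra S)"
      by (rule V.span_is_subset2) (auto simp: carrier)
    show "carrier (presented_algebra S) \<subseteq> V.span (range ?b)"
    proof
      fix x assume "x \<in> carrier (presented_algebra S)"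
      then obtain v where v: "x = coset_of S (linear_ext m v)"
        using surj by (auto simp: presented_algebra_sel)
      let ?a = "\<lambda>y. Poly_Mapping.lookup v (inv_into UNIV ?b y)"
      have "v = (\<Sum>i\<in>Poly_Mapping.keys v. Poly_Mapping.single i (?a (?b i)))"
        by (rule poly_mapping_eqI) (auto simp: lookup inv_f_f[OF inj_b] in_keys_iff)
      then have "x = V.lincomb ?a (?b ` Poly_Mapping.keys v)"
        using v lincomb[of "Poly_Mapping.keys v" ?a] by simp
      then show "x \<in> V.span (range ?b)"
        unfolding V.span_def by (intro CollectI exI conjI) auto
    qed
  qed
  ultimately show ?thesis
    using inj_b carrier unfolding V.basis_def by auto
qed

text \<open>A central coset consists of polynomials that commute with every polynomial modulo the relations.\<close>

lemma center_representative_commutes: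
  assumes "C0 \<in> center (presented_algebra S)" "c0 \<in> C0"
  shows "c0 * p - p * c0 \<in> relation_ideal S"
proof -
  interpret ideal "relation_ideal S" free_algebra by (rule ideal_relation_ideal)
  obtain s where s: "C0 = coset_of S s"
    using assms(1) by (auto simp: center_def presented_algebra_sel)
  then have C0: "C0 = coset_of S c0"
    using a_repr_independence'[of c0 s] assms(2) by (simp add: coset_of_def)
  have "coset_of S p \<in> carrier (presented_algebra S)"
    by (simp add: presented_algebra_sel)
  then have "C0 \<otimes>\<^bsub>presented_algebra S\<^esub> coset_of S p = coset_of S p \<otimes>\<^bsub>presented_algebra S\<^esub> C0"
    using assms(1) by (simp add: center_def)
  then show ?thesis
    by (simp add: C0 presented_algebra_sel coset_of_eq_iff)
qed

section \<open>The regular representation on the span of the PBW monomials\<close>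

text \<open>The index \<open>(a, b, c, d, e)\<close> stands for the monomial $F^a Y^b K^c X^d E^e$, so that
  \<open>'k pbw_space\<close> is the vector space that is to be identified with the algebra.\<close>

type_synonym index = "nat \<times> nat \<times> int \<times> nat \<times> nat"

type_synonym 'k pbw_space = "index \<Rightarrow>\<^sub>0 'k"

locale osc_construction =
  fixes q :: "'k::field" and c0 :: "(uq_gen, 'k) ncpoly"
  assumes q_nonzero [simp]: "q \<noteq> 0" and q_square: "q\<^sup>2 \<noteq> 1"
begin

definition q_inv :: 'k where "q_inv = inverse q"
definition h_coeff :: 'k where "h_coeff = 1 / (q - inverse q)"

lemma q_q_inv: "q * q_inv = 1"
  by (simp add: q_inv_def)

text \<open>The relation $(q - q^{-1}) h = 1$, oriented so that \<open>h_coeff * q\<close> is eliminated; together with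
  $q q^{-1} = 1$ it is all that the inductive steps of the commutation relations use about the coefficients.\<close>

lemma h_coeff_q: "h_coeff * q = 1 + h_coeff * q_inv"
proof -
  have "q - q_inv \<noteq> 0"
    using q_square by (auto simp: q_inv_def power2_eq_square field_simps)
  then have "h_coeff * (q - q_inv) = 1"
    by (simp add: h_coeff_def q_inv_def)
  then show ?thesis
    by (simp add: algebra_simps)
qed

lemma h_coeff_q_left:
  "h_coeff * (q * x) = x + h_coeff * (q_inv * x)"
  "q * (h_coeff * x) = x + h_coeff * (q_inv * x)"
proof -
  show "h_coeff * (q * x) = x + h_coeff * (q_inv * x)"
    by (simp add: h_coeff_q distrib_right flip: mult.assoc)
  then show "q * (h_coeff * x) = x + h_coeff * (q_inv * x)"
    by (simp add: mult.left_commute)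
qed

lemma q_q_inv_left: "q * (q_inv * x) = x" "q_inv * (q * x) = x"
  by (simp_all add: q_inv_def)

definition opF :: "'k pbw_space \<Rightarrow> 'k pbw_space"
  where "opF = linear_ext (\<lambda>(a, b, w). basis_vector (Suc a, b, w))"

definition opY :: "'k pbw_space \<Rightarrow> 'k pbw_space"
  where "opY = linear_ext (\<lambda>(a, b, w). basis_vector (a, Suc b, w))"

definition opK :: "'k pbw_space \<Rightarrow> 'k pbw_space"
  where "opK = linear_ext (\<lambda>(a, b, c, d, e). q_inv ^ (2 * a + b) *\<^sub>p basis_vector (a, b, c + 1, d, e))"

definition opK' :: "'k pbw_space \<Rightarrow> 'k pbw_space"
  where "opK' = linear_ext (\<lambda>(a, b, c, d, e). q ^ (2 * a + b) *\<^sub>p basis_vector (a, b, c - 1, d, e))"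

definition opH :: "'k pbw_space \<Rightarrow> 'k pbw_space"
  where "opH v = h_coeff *\<^sub>p (opK v - opK' v)"

text \<open>The parameter \<open>x\<close> is the action of \<open>X\<close> on the monomials without \<open>F\<close>: the vector
  \<open>x b (c, d, e)\<close> is meant to be $X \cdot Y^b K^c X^d E^e$. The clauses are read off from
  $E K^c X^d = q^{d - 2c} K^c X^d E$, $EY = X + q^{-1} Y E$ and
  $EF = FE + (K - K^{-1})/(q - q^{-1})$. Because \<open>x\<close> is a parameter, the recursion is structural.\<close>

fun E_value :: "(nat \<Rightarrow> int \<times> nat \<times> nat \<Rightarrow> 'k pbw_space) \<Rightarrow> index \<Rightarrow> 'k pbw_space" where
  "E_value x (0, 0, c, d, e) = q powi (int d - 2 * c) *\<^sub>p basis_vector (0, 0, c, d, Suc e)"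
| "E_value x (0, Suc b, w) = x b w + q_inv *\<^sub>p opY (E_value x (0, b, w))"
| "E_value x (Suc a, b, w) = opF (E_value x (a, b, w)) + opH (basis_vector (a, b, w))"

fun X_value :: "(nat \<Rightarrow> int \<times> nat \<times> nat \<Rightarrow> 'k pbw_space) \<Rightarrow> index \<Rightarrow> 'k pbw_space" where
  "X_value x (0, b, w) = x b w"
| "X_value x (Suc a, b, w) = opF (X_value x (a, b, w)) - opY (opK' (basis_vector (a, b, w)))"

fun uq_op :: "(nat \<Rightarrow> int \<times> nat \<times> nat \<Rightarrow> 'k pbw_space) \<Rightarrow> uq_gen \<Rightarrow> 'k pbw_space \<Rightarrow> 'k pbw_space" where
  "uq_op x E = linear_ext (E_value x)"
| "uq_op x F = opF"
| "uq_op x K = opK"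
| "uq_op x K' = opK'"

text \<open>The recursion $X \cdot Y^{n+1} w = q Y X \cdot Y^n w - C_0 \cdot Y^n w$, where
  $C_0 \cdot Y^n w$ needs the operator \<open>E\<close> and hence all the earlier values. Stage \<open>n\<close> is
  therefore a whole family that is correct at \<open>0, \<dots>, n\<close> and is changed only at \<open>n + 1\<close> in the next
  step; its entries beyond \<open>n\<close> are placeholders. The placeholder is the vector for exponent \<open>0\<close>,
  which lies in every piece of the filtration, so that all stages respect the filtration.\<close>

primrec X_stage :: "nat \<Rightarrow> nat \<Rightarrow> int \<times> nat \<times> nat \<Rightarrow> 'k pbw_space" where
  "X_stage 0 = (\<lambda>_ (c, d, e). q powi (- c) *\<^sub>p basis_vector (0, 0, c, Suc d, e))"
| "X_stage (Suc n) = (X_stage n)(Suc n := \<lambda>w.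
     q *\<^sub>p opY (X_stage n n w) - act (uq_op (X_stage n)) c0 (basis_vector (0, n, w)))"

definition X_seed :: "nat \<Rightarrow> int \<times> nat \<times> nat \<Rightarrow> 'k pbw_space"
  where "X_seed b = X_stage b b"

definition opE :: "'k pbw_space \<Rightarrow> 'k pbw_space"
  where "opE = linear_ext (E_value X_seed)"

definition opX :: "'k pbw_space \<Rightarrow> 'k pbw_space"
  where "opX = linear_ext (X_value X_seed)"

fun osc_op :: "osc_gen \<Rightarrow> 'k pbw_space \<Rightarrow> 'k pbw_space" where
  "osc_op (U g) = uq_op X_seed g"
| "osc_op X = opX"
| "osc_op Y = opY"

text \<open>The action of $C_0$, through the representative \<open>c0\<close>.\<close>

definition opC :: "'k pbw_space \<Rightarrow> 'k pbw_space"
  where "opC = act (uq_op X_seed) c0"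

lemma linear_op_uq_op: "linear_op (uq_op x g)"
  by (cases g) (simp_all add: opF_def opK_def opK'_def)

lemma linear_op_osc_op: "linear_op (osc_op g)"
  by (cases g) (simp_all add: linear_op_uq_op opX_def opY_def)

lemma op_linear [simp]:
  "opF 0 = 0" "opF (u + v) = opF u + opF v" "opF (c *\<^sub>p v) = c *\<^sub>p opF v" "opF (u - v) = opF u - opF v"
  "opY 0 = 0" "opY (u + v) = opY u + opY v" "opY (c *\<^sub>p v) = c *\<^sub>p opY v" "opY (u - v) = opY u - opY v"
  "opK 0 = 0" "opK (u + v) = opK u + opK v" "opK (c *\<^sub>p v) = c *\<^sub>p opK v" "opK (u - v) = opK u - opK v"
  "opK' 0 = 0" "opK' (u + v) = opK' u + opK' v" "opK' (c *\<^sub>p v) = c *\<^sub>p opK' v"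
  "opK' (u - v) = opK' u - opK' v"
  "opE 0 = 0" "opE (u + v) = opE u + opE v" "opE (c *\<^sub>p v) = c *\<^sub>p opE v" "opE (u - v) = opE u - opE v"
  "opX 0 = 0" "opX (u + v) = opX u + opX v" "opX (c *\<^sub>p v) = c *\<^sub>p opX v" "opX (u - v) = opX u - opX v"
  by (simp_all add: opF_def opY_def opK_def opK'_def opE_def opX_def)

lemma opC_linear [simp]:
  "opC 0 = 0" "opC (u + v) = opC u + opC v" "opC (c *\<^sub>p v) = c *\<^sub>p opC v" "opC (u - v) = opC u - opC v"
proof -
  have lin: "linear_op opC"
    unfolding opC_def by (rule linear_op_act) (rule linear_op_uq_op)
  show "opC 0 = 0" by (rule linear_op_zero[OF lin])
  show add: "opC (u + v) = opC u + opC v" for u v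
    using lin by (simp add: linear_op_def)
  show "opC (c *\<^sub>p v) = c *\<^sub>p opC v"
    using lin by (simp add: linear_op_def)
  show "opC (u - v) = opC u - opC v"
    by (metis add add_diff_cancel_right' diff_add_cancel)
qed

lemma opH_linear [simp]:
  "opH 0 = 0" "opH (u + v) = opH u + opH v" "opH (c *\<^sub>p v) = c *\<^sub>p opH v" "opH (u - v) = opH u - opH v"
  by (rule poly_mapping_eqI; simp add: opH_def lookup_add lookup_minus algebra_simps)+

section \<open>The filtration by the exponent of Y and the recursion for X\<close>

definition Y_filt :: "nat \<Rightarrow> 'k pbw_space set"
  where "Y_filt n = {v. Poly_Mapping.keys v \<subseteq> {(a, b, w). b \<le> n}}"

lemma Y_filt_closed [intro, simp]:
  "0 \<in> Y_filt n" "u \<in> Y_filt n \<Longrightarrow> v \<in> Y_filt n \<Longrightarrow> u + v \<in> Y_filt n"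
  "u \<in> Y_filt n \<Longrightarrow> v \<in> Y_filt n \<Longrightarrow> u - v \<in> Y_filt n" "v \<in> Y_filt n \<Longrightarrow> c *\<^sub>p v \<in> Y_filt n"
  "b \<le> n \<Longrightarrow> basis_vector (a, b, w) \<in> Y_filt n"
  unfolding Y_filt_def using keys_add[of u v] keys_diff[of u v] keys_scale[of c v] by auto

lemma Y_filt_mono: "v \<in> Y_filt m \<Longrightarrow> m \<le> n \<Longrightarrow> v \<in> Y_filt n"
  unfolding Y_filt_def by fastforce

lemma Y_filt_unit_induct [consumes 1, case_names zero add scale unit]:
  assumes "v \<in> Y_filt n" "P 0"
    and "\<And>u v. P u \<Longrightarrow> P v \<Longrightarrow> P (u + v)"
    and "\<And>c u. P u \<Longrightarrow> P (c *\<^sub>p u)"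
    and "\<And>a b w. b \<le> n \<Longrightarrow> P (basis_vector (a, b, w))"
  shows "P v"
proof -
  have "Poly_Mapping.keys v \<subseteq> {(a, b, w). b \<le> n}"
    using assms(1) by (simp add: Y_filt_def)
  then show ?thesis
    by (induction rule: vector_induct) (use assms in auto)
qed

lemma op_basis_vector [simp]:
  "opF (basis_vector (a, b, w)) = basis_vector (Suc a, b, w)"
  "opY (basis_vector (a, b, w)) = basis_vector (a, Suc b, w)"
  "opK (basis_vector (a, b, c, d, e)) = q_inv ^ (2 * a + b) *\<^sub>p basis_vector (a, b, c + 1, d, e)"
  "opK' (basis_vector (a, b, c, d, e)) = q ^ (2 * a + b) *\<^sub>p basis_vector (a, b, c - 1, d, e)"
  "opX (basis_vector (0, b, w)) = X_seed b w"
  by (simp_all add: opF_def opY_def opK_def opK'_def opX_def)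

text \<open>Since \<open>F\<close> preserves the filtration, a linear statement on a piece of it can be proved first for
  monomials without \<open>F\<close>, where the recursion for \<open>X\<close> applies, and then transported by \<open>F\<close>, using
  the relations of the operators with \<open>F\<close>.\<close>

lemma Y_filt_induct [consumes 1, case_names zero add scale base F]:
  assumes "v \<in> Y_filt n" "P 0"
    and "\<And>u v. P u \<Longrightarrow> P v \<Longrightarrow> P (u + v)"
    and "\<And>c u. P u \<Longrightarrow> P (c *\<^sub>p u)"
    and "\<And>b w. b \<le> n \<Longrightarrow> P (basis_vector (0, b, w))"
    and "\<And>v. v \<in> Y_filt n \<Longrightarrow> P v \<Longrightarrow> P (opF v)"
  shows "P v"
  using assms(1)
proof (induction rule: Y_filt_unit_induct)
  case (unit a b w)
  then show ?case
  proof (induction a)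
    case (Suc a)
    then show ?case
      using assms(6)[of "basis_vector (a, b, w)"] by simp
  qed (use assms in auto)
qed (use assms in auto)

lemma ex_filt: "\<exists>n. v \<in> Y_filt n"
proof -
  have "\<exists>n. \<forall>i\<in>Poly_Mapping.keys v. fst (snd i) \<le> n"
    using finite_nat_set_iff_bounded_le[of "(\<lambda>i. fst (snd i)) ` Poly_Mapping.keys v"] by auto
  then show ?thesis
    by (fastforce simp: Y_filt_def)
qed

lemma FY_induct [case_names zero add scale base Y F]:
  assumes "P 0"
    and "\<And>u v. P u \<Longrightarrow> P v \<Longrightarrow> P (u + v)"
    and "\<And>c u. P u \<Longrightarrow> P (c *\<^sub>p u)"
    and "\<And>c d e. P (basis_vector (0, 0, c, d, e))"
    and "\<And>v. P v \<Longrightarrow> P (opY v)"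
    and "\<And>v. P v \<Longrightarrow> P (opF v)"
  shows "P v"
proof -
  obtain n where "v \<in> Y_filt n"
    using ex_filt by blast
  then show ?thesis
  proof (induction rule: Y_filt_induct)
    case (base b w)
    show ?case
    proof (induction b)
      case 0
      show ?case using assms(4) by (cases w) auto
    next
      case (Suc b)
      show ?case using assms(5)[OF Suc] by simp
    qed
  qed (use assms in auto)
qed

lemma unit_induct [case_names zero add scale unit]:
  fixes v :: "'k pbw_space"
  assumes "P 0"
    and "\<And>u v. P u \<Longrightarrow> P v \<Longrightarrow> P (u + v)"
    and "\<And>c u. P u \<Longrightarrow> P (c *\<^sub>p u)"
    and "\<And>a b c d e. P (basis_vector (a, b, c, d, e))"
  shows "P v"
proof -
  have "Poly_Mapping.keys v \<subseteq> UNIV" by simp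
  then show ?thesis
    by (induction rule: vector_induct) (use assms in auto)
qed

lemma op_filt:
  assumes "v \<in> Y_filt n"
  shows "opF v \<in> Y_filt n" "opK v \<in> Y_filt n" "opK' v \<in> Y_filt n" "opY v \<in> Y_filt (Suc n)"
    and "opH v \<in> Y_filt n"
proof -
  show "opF v \<in> Y_filt n" "opY v \<in> Y_filt (Suc n)"
    using assms by (induction rule: Y_filt_unit_induct; auto)+
  show K: "opK v \<in> Y_filt n" "opK' v \<in> Y_filt n"
    using assms by (induction rule: Y_filt_unit_induct; auto split: prod.splits)+
  show "opH v \<in> Y_filt n"
    using K by (simp add: opH_def)
qed

text \<open>The term \<open>x b w\<close> occurs in the value of \<open>E\<close> at exponent \<open>b + 1\<close> and lies one step lower, while \<open>Y\<close>
  raises the exponent of the other term by one; so \<open>E\<close> does not raise the exponent of \<open>Y\<close>.\<close>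

lemma E_value_filt: "(\<And>m w. x m w \<in> Y_filt m) \<Longrightarrow> E_value x (a, b, w) \<in> Y_filt b"
proof (induction x "(a, b, w)" arbitrary: a b w rule: E_value.induct)
  case (2 x b w)
  then show ?case
    using Y_filt_mono[of "x b w" b "Suc b"] op_filt(4)[of "E_value x (0, b, w)" b] by simp
qed (auto intro: op_filt)

lemma uq_op_filt:
  assumes "\<And>m w. x m w \<in> Y_filt m" "v \<in> Y_filt n"
  shows "uq_op x g v \<in> Y_filt n"
proof (cases g)
  case E
  have "linear_ext (E_value x) v \<in> Y_filt n"
    using assms(2)
    by (induction rule: Y_filt_unit_induct) (auto intro: Y_filt_mono[OF E_value_filt] assms(1))
  then show ?thesis using E by simp
qed (use op_filt[OF assms(2)] in auto)

lemma act_uq_op_filt: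
  assumes "\<And>m w. x m w \<in> Y_filt m" "v \<in> Y_filt n"
  shows "act (uq_op x) p v \<in> Y_filt n"
  using keys_act[of "{(a, b, w). b \<le> n}" "uq_op x" v p] uq_op_filt[OF assms(1)] assms(2)
  by (auto simp: Y_filt_def)

lemma X_stage_filt: "X_stage n m w \<in> Y_filt m"
proof (induction n arbitrary: m w)
  case 0
  then show ?case by (cases w) auto
next
  case (Suc n)
  then show ?case
    using Y_filt_mono[OF act_uq_op_filt[of "X_stage n" "basis_vector (0, n, w)" n c0], of "Suc n"]
      op_filt(4)[of "X_stage n n w" n] by simp
qed

lemma X_seed_filt: "X_seed m w \<in> Y_filt m"
  by (simp add: X_seed_def X_stage_filt)

lemma X_stage_stable: "m \<le> n \<Longrightarrow> X_stage n m = X_seed m"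
  by (induction n) (auto simp: X_seed_def le_Suc_eq)

text \<open>This is what makes the recursion for \<open>X\<close> well-founded: at exponent \<open>b\<close> the operator \<open>E\<close> sees \<open>X\<close> only
  through strictly smaller exponents.\<close>

lemma E_value_cong:
  "(\<And>m. m < b \<Longrightarrow> x m = y m) \<Longrightarrow> E_value x (a, b, w) = E_value y (a, b, w)"
  by (induction x "(a, b, w)" arbitrary: a b w rule: E_value.induct) auto

lemma uq_op_cong:
  assumes "\<And>m. m < n \<Longrightarrow> x m = y m" "v \<in> Y_filt n"
  shows "uq_op x g v = uq_op y g v"
proof (cases g)
  case E
  have "linear_ext (E_value x) v = linear_ext (E_value y) v"
    using assms(2) by (intro linear_ext_cong) (auto simp: Y_filt_def intro!: E_value_cong assms(1))
  then show ?thesis using E by simp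
qed auto

lemma act_uq_op_cong:
  assumes "\<And>m. m < n \<Longrightarrow> x m = y m" "\<And>m w. y m w \<in> Y_filt m" "v \<in> Y_filt n"
  shows "act (uq_op x) p v = act (uq_op y) p v"
proof -
  have "foldr (uq_op x) ws v = foldr (uq_op y) ws v \<and> foldr (uq_op y) ws v \<in> Y_filt n" for ws
    by (induction ws) (use assms uq_op_filt uq_op_cong[OF assms(1)] in auto)
  then show ?thesis
    by (simp add: act_def)
qed

lemma X_seed_0: "X_seed 0 (c, d, e) = q powi (- c) *\<^sub>p basis_vector (0, 0, c, Suc d, e)"
  by (simp add: X_seed_def)

text \<open>On vectors of exponent at most \<open>n\<close> the \<open>n\<close>-th stage already gives the final operators, so the
  recursion for the stages becomes the relation $XY = qYX - C_0$ on monomials without \<open>F\<close>.\<close>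

lemma X_seed_Suc: "X_seed (Suc n) w = q *\<^sub>p opY (X_seed n w) - opC (basis_vector (0, n, w))"
proof -
  have "act (uq_op (X_stage n)) c0 (basis_vector (0, n, w)) = opC (basis_vector (0, n, w))"
    unfolding opC_def by (rule act_uq_op_cong[of n]) (auto simp: X_stage_stable X_seed_filt)
  then show ?thesis
    by (simp add: X_seed_def)
qed

section \<open>The defining relations hold for the operators\<close>

lemma Y_F: "opY (opF v) = opF (opY v)"
  by (induction v rule: unit_induct) simp_all

lemma K_K' [simp]: "opK (opK' v) = v" and K'_K [simp]: "opK' (opK v) = v"
  by (induction v rule: unit_induct; simp add: q_q_inv mult.commute[of q_inv] flip: power_mult_distrib)+

lemma K_F: "opK (opF v) = q_inv\<^sup>2 *\<^sub>p opF (opK v)"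
  and K'_F: "opK' (opF v) = q\<^sup>2 *\<^sub>p opF (opK' v)"
  and K_Y: "opK (opY v) = q_inv *\<^sub>p opY (opK v)"
  and K'_Y: "opK' (opY v) = q *\<^sub>p opY (opK' v)"
  by (induction v rule: unit_induct; simp add: scale_add power2_eq_square mult_ac)+

lemma E_F: "opE (opF v) = opF (opE v) + opH v"
  by (induction v rule: unit_induct) (simp_all add: scale_add opE_def)

lemma X_F: "opX (opF v) = opF (opX v) - opY (opK' v)"
  by (induction v rule: unit_induct) (simp_all add: scale_diff opX_def del: op_basis_vector, simp_all)

lemmas lookup_linear = lookup_add lookup_minus lookup_scale

text \<open>On monomials without \<open>F\<close> this is the definition of \<open>E\<close>. Moving the relation past \<open>F\<close> produces
  $HY$ on the left and $q^{-1} Y H$ on the right, where $H = [E, F]$; their difference is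
  $-YK^{-1}$, the term that arises when \<open>X\<close> is moved past \<open>F\<close>.\<close>

lemma E_Y: "opE (opY v) = opX v + q_inv *\<^sub>p opY (opE v)"
proof -
  obtain n where "v \<in> Y_filt n"
    using ex_filt by blast
  then show ?thesis
  proof (induction rule: Y_filt_induct)
    case (base b w)
    then show ?case by (simp add: opE_def)
  next
    case (F v)
    then show ?case
      by (intro poly_mapping_eqI)
        (simp add: Y_F E_F X_F F.IH opH_def K_Y K'_Y lookup_linear algebra_simps h_coeff_q_left)
  qed (simp_all add: scale_add algebra_simps)
qed

lemma K_E_F:
  assumes "opK (opE v) = q\<^sup>2 *\<^sub>p opE (opK v)"
  shows "opK (opE (opF v)) = q\<^sup>2 *\<^sub>p opE (opK (opF v))"
  by (rule poly_mapping_eqI)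
   (simp add: E_F K_F opH_def assms lookup_linear power2_eq_square q_q_inv_left q_q_inv algebra_simps)

lemma K_X_F:
  assumes "opK (opX v) = q *\<^sub>p opX (opK v)"
  shows "opK (opX (opF v)) = q *\<^sub>p opX (opK (opF v))"
  by (rule poly_mapping_eqI)
   (simp add: X_F K_F K_Y assms lookup_linear power2_eq_square q_q_inv_left q_q_inv algebra_simps)

text \<open>At exponent \<open>0\<close> the element $C_0$ does not enter, and the powers of \<open>q\<close> can be compared directly.\<close>

lemma K_E_K_X_0:
  assumes "v \<in> Y_filt 0"
  shows "opK (opE v) = q\<^sup>2 *\<^sub>p opE (opK v)" "opK (opX v) = q *\<^sub>p opX (opK v)"
  using assms
proof (induction rule: Y_filt_induct)
  case (base b w)
  obtain c d e where [simp]: "w = (c, d, e)" "b = 0"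
    using base by (cases w) auto
  have "q\<^sup>2 * q powi (int d - 2 * (c + 1)) = q powi (int d - 2 * c)"
     "q * q powi (- (c + 1)) = q powi (- c)"
    by (simp_all add: power_int_add power_int_diff power_int_minus field_simps power2_eq_square)
  then show "opK (opE (basis_vector (0, b, w))) = q\<^sup>2 *\<^sub>p opE (opK (basis_vector (0, b, w)))"
     "opK (opX (basis_vector (0, b, w))) = q *\<^sub>p opX (opK (basis_vector (0, b, w)))"
    by (simp_all add: opE_def X_seed_0)
qed (simp_all add: scale_add K_E_F K_X_F mult.commute)

lemma uq_op_X_seed: "uq_op X_seed E = opE"
  by (simp add: opE_def)

text \<open>Among the relations of $U_q(\mathfrak{sl}_2)$ only the one between \<open>K\<close> and \<open>E\<close> is not yet known, and
  it is only needed on the piece of the filtration under consideration.\<close>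

lemma uq_relators_act_by_zero:
  assumes K_E: "\<And>v. v \<in> Y_filt n \<Longrightarrow> opK (opE v) = q\<^sup>2 *\<^sub>p opE (opK v)"
    and "\<rho> \<in> uq_relators q" "v \<in> Y_filt n"
  shows "act (uq_op X_seed) \<rho> v = 0"
proof -
  have "opK (opE (opK' v)) = q\<^sup>2 *\<^sub>p opE v"
    using K_E[OF op_filt(3)[OF assms(3)]] by simp
  moreover have "opK (opF (opK' v)) = (inverse (q\<^sup>2)) *\<^sub>p opF v"
    by (simp add: K_F q_inv_def power_inverse)
  ultimately show ?thesis
    using assms(2)
    by (auto simp: uq_relators_def act_mult[OF linear_op_uq_op] uq_op_X_seed E_F opH_def h_coeff_def
        simp del: uq_op.simps(1))
qed

end

text \<open>Centrality of $C_0$ in $U_q(\mathfrak{sl}_2)$, expressed for the representative \<open>c0\<close>.\<close>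

locale central_osc_construction = osc_construction +
  assumes central: "c0 * p - p * c0 \<in> relation_ideal (uq_relators q)"
begin

text \<open>The piece of the filtration is a module over $U_q(\mathfrak{sl}_2)$, on which a commutator with \<open>c0\<close>
  acts by zero because it lies in the relation ideal.\<close>

lemma opC_commute:
  assumes K_E: "\<And>v. v \<in> Y_filt n \<Longrightarrow> opK (opE v) = q\<^sup>2 *\<^sub>p opE (opK v)"
    and "v \<in> Y_filt n"
  shows "opC (opE v) = opE (opC v)" "opC (opF v) = opF (opC v)" "opC (opK v) = opK (opC v)"
proof -
  have "opC (uq_op X_seed g v) = uq_op X_seed g (opC v)" for g
  proof -
    have "act (uq_op X_seed) (c0 * var g - var g * c0) v = 0"
      by (rule relation_ideal_acts_by_zero[OF linear_op_uq_op,
            where J = "{(a, b, w). b \<le> n}" and S = "uq_relators q"])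
        (use uq_op_filt[OF X_seed_filt, of _ n] uq_relators_act_by_zero[OF K_E] central assms(2)
          in \<open>simp_all add: Y_filt_def\<close>)
    then show ?thesis
      by (simp add: act_mult[OF linear_op_uq_op] opC_def)
  qed
  from this[of E] this[of F] this[of K]
  show "opC (opE v) = opE (opC v)" "opC (opF v) = opF (opC v)" "opC (opK v) = opK (opC v)"
    by (simp_all add: opE_def)
qed

text \<open>To pass from \<open>v\<close> to \<open>F v\<close>, both sides are commuted with \<open>F\<close>; what remains is exactly that $C_0$
  commutes with \<open>F\<close>.\<close>

lemma X_Y_filt:
  assumes K_E: "\<And>v. v \<in> Y_filt n \<Longrightarrow> opK (opE v) = q\<^sup>2 *\<^sub>p opE (opK v)"
    and "v \<in> Y_filt n"
  shows "opX (opY v) = q *\<^sub>p opY (opX v) - opC v"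
  using assms(2)
proof (induction rule: Y_filt_induct)
  case (base b w)
  then show ?case by (simp add: X_seed_Suc)
next
  case (F v)
  show ?case
    by (rule poly_mapping_eqI)
      (simp add: Y_F X_F K'_Y opC_commute(2)[OF K_E F(1)] F(2) lookup_linear algebra_simps)
qed (simp_all add: scale_add scale_diff mult.commute)

text \<open>Both relations must be carried through the induction together: for \<open>K E\<close> at \<open>Y v\<close> one needs \<open>K X\<close> at \<open>v\<close>,
  because $EY = X + q^{-1} Y E$, and for \<open>K X\<close> at \<open>Y v\<close> one needs that $C_0$ commutes with \<open>K\<close> at \<open>v\<close>,
  which rests on \<open>K E\<close>.\<close>

lemma K_E_K_X_filt:
  "(\<forall>v\<in>Y_filt n. opK (opE v) = q\<^sup>2 *\<^sub>p opE (opK v)) \<and>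
    (\<forall>v\<in>Y_filt n. opK (opX v) = q *\<^sub>p opX (opK v))"
proof (induction n)
  case 0
  show ?case
    using K_E_K_X_0 by blast
next
  case (Suc n)
  have K_E: "opK (opE v) = q\<^sup>2 *\<^sub>p opE (opK v)" and K_X: "opK (opX v) = q *\<^sub>p opX (opK v)"
    if "v \<in> Y_filt n" for v
    using Suc that by auto
  have K_X_Y: "opK (opX (opY v)) = q *\<^sub>p opX (opK (opY v))" if v: "v \<in> Y_filt n" for v
    by (rule poly_mapping_eqI)
      (simp add: X_Y_filt[OF K_E] op_filt v K_Y K_X opC_commute(3)[OF K_E v] lookup_linear
        q_q_inv_left q_q_inv algebra_simps)
  have K_E_Y: "opK (opE (opY v)) = q\<^sup>2 *\<^sub>p opE (opK (opY v))" if v: "v \<in> Y_filt n" for v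
    by (rule poly_mapping_eqI)
      (simp add: E_Y K_Y K_X K_E v power2_eq_square lookup_linear q_q_inv_left q_q_inv algebra_simps)
  have "opK (opE v) = q\<^sup>2 *\<^sub>p opE (opK v) \<and> opK (opX v) = q *\<^sub>p opX (opK v)"
    if "v \<in> Y_filt (Suc n)" for v
    using that
  proof (induction rule: Y_filt_induct)
    case (base b w)
    show ?case
    proof (cases "b = Suc n")
      case True
      then show ?thesis
        using K_X_Y[of "basis_vector (0, n, w)"] K_E_Y[of "basis_vector (0, n, w)"] by simp
    next
      case False
      then show ?thesis
        using base K_E[of "basis_vector (0, b, w)"] K_X[of "basis_vector (0, b, w)"] by auto
    qed
  qed (simp_all add: scale_add K_E_F K_X_F mult.commute)
  then show ?case by blast
qed

lemma K_E: "opK (opE v) = q\<^sup>2 *\<^sub>p opE (opK v)" and K_X: "opK (opX v) = q *\<^sub>p opX (opK v)"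
  using ex_filt[of v] K_E_K_X_filt by blast+

lemma C_E: "opC (opE v) = opE (opC v)"
  using ex_filt[of v] opC_commute(1)[OF K_E] by blast

lemma X_Y: "opX (opY v) = q *\<^sub>p opY (opX v) - opC v"
  using ex_filt[of v] X_Y_filt[OF K_E] by blast

lemma K'_E: "opK' (opE v) = q_inv\<^sup>2 *\<^sub>p opE (opK' v)"
  and K'_X: "opK' (opX v) = q_inv *\<^sub>p opX (opK' v)"
proof -
  have "opK' (opE (opK u)) = opK' (q_inv\<^sup>2 *\<^sub>p opK (opE u))"
    "opK' (opX (opK u)) = opK' (q_inv *\<^sub>p opK (opX u))" for u
    by (simp_all add: K_E K_X q_q_inv power2_eq_square q_q_inv_left algebra_simps)
  from this[of "opK' v"]
  show "opK' (opE v) = q_inv\<^sup>2 *\<^sub>p opE (opK' v)" "opK' (opX v) = q_inv *\<^sub>p opX (opK' v)"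
    by simp_all
qed

text \<open>In the step for \<open>Y\<close> the terms $qX^2$ cancel, and $C_0 E = E C_0$ accounts for the rest.\<close>

lemma E_X: "opE (opX v) = q *\<^sub>p opX (opE v)"
proof (induction v rule: FY_induct)
  case (base c d e)
  have "q powi (- c) * q powi (1 + int d - 2 * c) = q * (q powi (int d - 2 * c) * q powi (- c))"
    by (simp add: power_int_add power_int_diff power_int_minus field_simps)
  then show ?case
    by (simp add: opE_def X_seed_0 mult_ac)
next
  case (Y v)
  show ?case
    by (rule poly_mapping_eqI)
      (simp add: X_Y E_Y Y C_E lookup_linear q_q_inv_left q_q_inv algebra_simps)
next
  case (F v)
  have K'_E': "opE (opK' u) = q\<^sup>2 *\<^sub>p opK' (opE u)" for u
    by (simp add: K'_E q_q_inv power2_eq_square q_q_inv_left algebra_simps)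
  show ?case
    by (rule poly_mapping_eqI)
      (simp add: X_F E_F E_Y F opH_def K_X K'_X K'_E' power2_eq_square lookup_linear h_coeff_q_left
        q_q_inv_left q_q_inv algebra_simps)
qed (simp_all add: scale_add mult.commute)

end

section \<open>The algebra as a quotient of the representation space\<close>

context osc_construction
begin

definition K_power :: "int \<Rightarrow> (osc_gen, 'k) ncpoly"
  where "K_power c = (if c < 0 then var (U K') ^ nat (- c) else var (U K) ^ nat c)"

definition monomial :: "index \<Rightarrow> (osc_gen, 'k) ncpoly"
  where "monomial = (\<lambda>(a, b, c, d, e).
    var (U F) ^ a * (var Y ^ b * (K_power c * (var X ^ d * var (U E) ^ e))))"

text \<open>The residue class of a polynomial in the algebra. Congruences between polynomials are written as
  equations between their classes, so that they can be chained.\<close>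

definition cl :: "(osc_gen, 'k) ncpoly \<Rightarrow> (osc_gen, 'k) ncpoly set"
  where "cl = coset_of (osc_relators q c0)"

lemma cl_cong:
  assumes "cl p = cl p'"
  shows "cl (t * p) = cl (t * p')" "cl (p * t) = cl (p' * t)" "cl (c *\<^sub>p p) = cl (c *\<^sub>p p')"
  using assms unfolding cl_def by (fact coset_of_cong)+

lemma cl_cong2:
  assumes "cl p = cl p'" "cl s = cl s'"
  shows "cl (p + s) = cl (p' + s')" "cl (p - s) = cl (p' - s')"
  using assms unfolding cl_def by (fact coset_of_cong_add coset_of_cong_diff)+

lemma cl_relator: "p - s \<in> osc_relators q c0 \<Longrightarrow> cl p = cl s"
  unfolding cl_def by (rule coset_of_relator)

lemma cl_uq_relator: "p - s \<in> uq_relators q \<Longrightarrow> cl (rename U p) = cl (rename U s)"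
  by (rule cl_relator) (auto simp: osc_relators_def simp flip: rename_simps(2))

lemma cl_K_K': "cl (var (U K) * var (U K')) = cl 1" "cl (var (U K') * var (U K)) = cl 1"
  using cl_uq_relator[of "var K * var K'" 1] cl_uq_relator[of "var K' * var K" 1]
  by (simp_all add: uq_relators_def rename_mult)

lemma cl_E_F:
  "cl (var (U E) * var (U F)) = cl (var (U F) * var (U E) + h_coeff *\<^sub>p (var (U K) - var (U K')))"
  using cl_cong2(1)[OF cl_uq_relator[of "var E * var F - var F * var E"
        "scalar (1 / (q - inverse q)) * (var K - var K')"],
      of "var (U F) * var (U E)" "var (U F) * var (U E)"]
  by (simp add: uq_relators_def rename_mult scalar_eq_scale h_coeff_def add.commute)

lemma cl_osc:
  "cl (var (U E) * var X) = cl (q *\<^sub>p (var X * var (U E)))"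
  "cl (var (U E) * var Y) = cl (var X + q_inv *\<^sub>p (var Y * var (U E)))"
  "cl (var (U F) * var X) = cl (var Y * var (U K') + var X * var (U F))"
  "cl (var (U F) * var Y) = cl (var Y * var (U F))"
  "cl (var X * var Y) = cl (q *\<^sub>p (var Y * var X) - rename U c0)"
proof -
  have "cl (var (U E) * var X) = cl (scalar q * var X * var (U E))"
    by (rule cl_relator) (simp add: osc_relators_def)
  then show "cl (var (U E) * var X) = cl (q *\<^sub>p (var X * var (U E)))"
    by (simp add: scalar_eq_scale)
  have "cl (var (U E) * var Y) = cl (var X + scalar (inverse q) * var Y * var (U E))"
    by (rule cl_relator) (simp add: osc_relators_def)
  then show "cl (var (U E) * var Y) = cl (var X + q_inv *\<^sub>p (var Y * var (U E)))"
    by (simp add: scalar_eq_scale q_inv_def)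
  show "cl (var (U F) * var X) = cl (var Y * var (U K') + var X * var (U F))"
    "cl (var (U F) * var Y) = cl (var Y * var (U F))"
    by (rule cl_relator; simp add: osc_relators_def)+
  have "cl (scalar q * var Y * var X - var X * var Y) = cl (rename U c0)"
    by (rule cl_relator) (simp add: osc_relators_def)
  from cl_cong2(2)[OF refl this, of "scalar q * var Y * var X"]
  show "cl (var X * var Y) = cl (q *\<^sub>p (var Y * var X) - rename U c0)"
    by (simp add: scalar_eq_scale)
qed

text \<open>The relations that conjugate by \<open>K\<close>, turned into commutation rules.\<close>

lemma cl_K_conj:
  assumes "cl (var (U K) * g * var (U K')) = cl (s *\<^sub>p g)"
  shows "cl (var (U K) * g) = cl (s *\<^sub>p (g * var (U K)))"
proof -
  have "cl (var (U K) * g) = cl (var (U K) * g * (var (U K') * var (U K)))"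
    using cl_cong(1)[OF cl_K_K'(2), of "var (U K) * g"] by simp
  also have "\<dots> = cl (s *\<^sub>p (g * var (U K)))"
    using cl_cong(2)[OF assms, of "var (U K)"] by (simp add: mult.assoc)
  finally show ?thesis .
qed

lemma cl_K_commute:
  "cl (var (U K) * var (U E)) = cl (q\<^sup>2 *\<^sub>p (var (U E) * var (U K)))"
  "cl (var (U K) * var (U F)) = cl (q_inv\<^sup>2 *\<^sub>p (var (U F) * var (U K)))"
  "cl (var (U K) * var X) = cl (q *\<^sub>p (var X * var (U K)))"
  "cl (var (U K) * var Y) = cl (q_inv *\<^sub>p (var Y * var (U K)))"
proof -
  have "cl (var (U K) * var (U E) * var (U K')) = cl (q\<^sup>2 *\<^sub>p var (U E))"
    using cl_uq_relator[of "var K * var E * var K'" "scalar (q\<^sup>2) * var E"]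
    by (simp add: uq_relators_def rename_mult scalar_eq_scale)
  then show "cl (var (U K) * var (U E)) = cl (q\<^sup>2 *\<^sub>p (var (U E) * var (U K)))"
    by (rule cl_K_conj)
  have "cl (var (U K) * var (U F) * var (U K')) = cl (q_inv\<^sup>2 *\<^sub>p var (U F))"
    using cl_uq_relator[of "var K * var F * var K'" "scalar (inverse (q\<^sup>2)) * var F"]
    by (simp add: uq_relators_def rename_mult scalar_eq_scale q_inv_def power_inverse)
  then show "cl (var (U K) * var (U F)) = cl (q_inv\<^sup>2 *\<^sub>p (var (U F) * var (U K)))"
    by (rule cl_K_conj)
  have "cl (var (U K) * var X * var (U K')) = cl (scalar q * var X)"
    by (rule cl_relator) (simp add: osc_relators_def)
  then show "cl (var (U K) * var X) = cl (q *\<^sub>p (var X * var (U K)))"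
    by (intro cl_K_conj) (simp add: scalar_eq_scale)
  have "cl (var (U K) * var Y * var (U K')) = cl (scalar (inverse q) * var Y)"
    by (rule cl_relator) (simp add: osc_relators_def)
  then show "cl (var (U K) * var Y) = cl (q_inv *\<^sub>p (var Y * var (U K)))"
    by (intro cl_K_conj) (simp add: scalar_eq_scale q_inv_def)
qed

text \<open>A lift to the free algebra of the linear map from the representation space to the algebra.\<close>

definition to_free :: "'k pbw_space \<Rightarrow> (osc_gen, 'k) ncpoly"
  where "to_free = linear_ext monomial"

lemma to_free_linear [simp]:
  "to_free 0 = 0" "to_free (u + v) = to_free u + to_free v" "to_free (c *\<^sub>p v) = c *\<^sub>p to_free v"
  "to_free (u - v) = to_free u - to_free v" "to_free (basis_vector i) = monomial i"
  by (simp_all add: to_free_def)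

lemma to_free_opF: "to_free (opF v) = var (U F) * to_free v"
  by (induction v rule: unit_induct) (simp_all add: monomial_def distrib_left scale_add mult.assoc)

lemma to_free_opY_0: "to_free (opY (basis_vector (0, b, w))) = var Y * to_free (basis_vector (0, b, w))"
  by (cases w) (simp add: monomial_def mult.assoc)

text \<open>At the vector \<open>v\<close>, the map to the algebra carries the operator \<open>T\<close> to left multiplication by \<open>p\<close>.
  The notion is local in \<open>v\<close> because for \<open>E\<close> and \<open>X\<close> it is established along the filtration.\<close>

definition intertwined ::
    "('k pbw_space \<Rightarrow> 'k pbw_space) \<Rightarrow> (osc_gen, 'k) ncpoly \<Rightarrow> 'k pbw_space \<Rightarrow> bool"
  where "intertwined T p v \<longleftrightarrow> cl (to_free (T v)) = cl (p * to_free v)"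

lemma intertwinedD: "intertwined T p v \<Longrightarrow> cl (to_free (T v)) = cl (p * to_free v)"
  by (simp add: intertwined_def)

lemma intertwined_linear:
  assumes "linear_op T"
  shows "intertwined T p 0" "intertwined T p u \<Longrightarrow> intertwined T p v \<Longrightarrow> intertwined T p (u + v)"
    "intertwined T p v \<Longrightarrow> intertwined T p (c *\<^sub>p v)"
  using assms cl_cong2(1)[of "to_free (T u)" "p * to_free u" "to_free (T v)" "p * to_free v"]
     cl_cong(3)[of "to_free (T v)" "p * to_free v" c]
  by (simp_all add: intertwined_def linear_op_zero linear_op_def distrib_left)

lemma intertwined_F: "intertwined opF (var (U F)) v"
  by (simp add: intertwined_def to_free_opF)

lemma intertwined_Y: "intertwined opY (var Y) v"
proof -
  obtain n where "v \<in> Y_filt n"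
    using ex_filt by blast
  then show ?thesis
  proof (induction rule: Y_filt_induct)
    case (base b w)
    then show ?case by (simp only: intertwined_def to_free_opY_0)
  next
    case (F v)
    have "cl (to_free (opY (opF v))) = cl (var (U F) * to_free (opY v))"
      by (simp add: Y_F to_free_opF)
    also have "\<dots> = cl (var (U F) * (var Y * to_free v))"
      by (intro cl_cong intertwinedD F)
    also have "\<dots> = cl (var Y * to_free (opF v))"
      using cl_cong(2)[OF cl_osc(4), of "to_free v"] by (simp add: to_free_opF mult.assoc)
    finally show ?case
      by (simp add: intertwined_def)
  qed (simp_all add: intertwined_linear linear_op_osc_op[of Y, simplified])
qed

lemma K_power_add_1: "cl (K_power (c + 1)) = cl (var (U K) * K_power c)"
proof (cases "c < 0")
  case True
  define m where "m = nat (- (c + 1))"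
  have m: "nat (- c) = Suc m" "nat (- (c + 1)) = m"
    using True by (auto simp: m_def)
  have "K_power (c + 1) = var (U K') ^ m"
    using m True by (auto simp: K_power_def)
  moreover have "cl (var (U K) * K_power c) = cl (var (U K') ^ m)"
    using cl_cong(2)[OF cl_K_K'(1), of "var (U K') ^ m"] m True by (simp add: K_power_def mult.assoc)
  ultimately show ?thesis by simp
qed (simp add: K_power_def nat_add_distrib)

lemma K_power_diff_1: "cl (K_power (c - 1)) = cl (var (U K') * K_power c)"
proof -
  have "cl (var (U K') * K_power c) = cl (var (U K') * (var (U K) * K_power (c - 1)))"
    using cl_cong(1)[OF K_power_add_1[of "c - 1"], of "var (U K')"] by simp
  also have "\<dots> = cl (K_power (c - 1))"
    using cl_cong(2)[OF cl_K_K'(2), of "K_power (c - 1)"] by (simp add: mult.assoc)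
  finally show ?thesis by simp
qed

lemma intertwined_K: "intertwined opK (var (U K)) v"
proof (induction v rule: FY_induct)
  case (base c d e)
  show ?case
    using cl_cong(2)[OF K_power_add_1[of c], of "var X ^ d * var (U E) ^ e"]
    by (simp add: intertwined_def monomial_def mult.assoc)
next
  case (Y v)
  have "cl (to_free (opK (opY v))) = cl (q_inv *\<^sub>p (var Y * to_free (opK v)))"
    unfolding K_Y to_free_linear by (intro cl_cong intertwinedD intertwined_Y)
  also have "\<dots> = cl (q_inv *\<^sub>p (var Y * (var (U K) * to_free v)))"
    by (intro cl_cong intertwinedD Y)
  also have "\<dots> = cl (var (U K) * (var Y * to_free v))"
    using cl_cong(2)[OF cl_K_commute(4), of "to_free v"] by (simp add: mult.assoc)
  also have "\<dots> = cl (var (U K) * to_free (opY v))"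
    by (intro cl_cong intertwinedD[symmetric] intertwined_Y)
  finally show ?case
    by (simp add: intertwined_def)
next
  case (F v)
  have "cl (to_free (opK (opF v))) = cl (q_inv\<^sup>2 *\<^sub>p (var (U F) * to_free (opK v)))"
    by (simp add: K_F to_free_opF)
  also have "\<dots> = cl (q_inv\<^sup>2 *\<^sub>p (var (U F) * (var (U K) * to_free v)))"
    by (intro cl_cong intertwinedD F)
  also have "\<dots> = cl (var (U K) * to_free (opF v))"
    using cl_cong(2)[OF cl_K_commute(2), of "to_free v"] by (simp add: to_free_opF mult.assoc)
  finally show ?case
    by (simp add: intertwined_def)
qed (simp_all add: intertwined_linear linear_op_osc_op[of "U K", simplified])

lemma intertwined_K': "intertwined opK' (var (U K')) v"
proof -
  have "cl (to_free (opK' v)) = cl (var (U K') * (var (U K) * to_free (opK' v)))"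
    using cl_cong(2)[OF cl_K_K'(2), of "to_free (opK' v)"] by (simp add: mult.assoc)
  also have "\<dots> = cl (var (U K') * to_free (opK (opK' v)))"
    by (intro cl_cong intertwinedD[symmetric] intertwined_K)
  finally show ?thesis
    by (simp add: intertwined_def)
qed

text \<open>For negative exponents one needs $g K^{-1} = s^{-1} K^{-1} g$, obtained by multiplying the hypothesis
  with $K^{-1}$ from both sides.\<close>

lemma cl_mult_K_power:
  assumes comm: "cl (g * var (U K)) = cl (s *\<^sub>p (var (U K) * g))" and "s \<noteq> 0"
  shows "cl (g * K_power c) = cl (s powi c *\<^sub>p (K_power c * g))"
proof (induction c rule: int_induct[where k = 0])
  case base
  show ?case by (simp add: K_power_def)
next
  case (step1 c)
  have "cl (g * K_power (c + 1)) = cl (g * var (U K) * K_power c)"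
    using cl_cong(1)[OF K_power_add_1, of g] by (simp add: mult.assoc)
  also have "\<dots> = cl (s *\<^sub>p (var (U K) * (g * K_power c)))"
    using cl_cong(2)[OF comm, of "K_power c"] by (simp add: mult.assoc)
  also have "\<dots> = cl (s *\<^sub>p (var (U K) * (s powi c *\<^sub>p (K_power c * g))))"
    by (intro cl_cong step1)
  also have "\<dots> = cl ((s * s powi c) *\<^sub>p (K_power (c + 1) * g))"
    using cl_cong(3)[OF cl_cong(2)[OF K_power_add_1[of c], of g], of "s * s powi c"]
    by (simp add: mult.assoc)
  finally show ?case
    using \<open>s \<noteq> 0\<close> by (simp add: power_int_add mult.commute)
next
  case (step2 c)
  have "cl (var (U K') * (s *\<^sub>p (var (U K) * g)) * var (U K'))
      = cl (var (U K') * (g * var (U K)) * var (U K'))"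
    by (intro cl_cong comm[symmetric])
  also have "\<dots> = cl (var (U K') * g * (var (U K) * var (U K')))"
    by (simp add: mult.assoc)
  also have "\<dots> = cl (var (U K') * g)"
    using cl_cong(1)[OF cl_K_K'(1), of "var (U K') * g"] by simp
  finally have "cl (s *\<^sub>p ((var (U K') * var (U K)) * (g * var (U K')))) = cl (var (U K') * g)"
    by (simp add: mult.assoc)
  then have "cl (s *\<^sub>p (g * var (U K'))) = cl (var (U K') * g)"
    using cl_cong(3)[OF cl_cong(2)[OF cl_K_K'(2), of "g * var (U K')"], of s] by simp
  from cl_cong(3)[OF this, of "inverse s"]
  have comm': "cl (g * var (U K')) = cl (inverse s *\<^sub>p (var (U K') * g))"
    using \<open>s \<noteq> 0\<close> by simp
  have "cl (g * K_power (c - 1)) = cl (g * var (U K') * K_power c)"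
    using cl_cong(1)[OF K_power_diff_1, of g] by (simp add: mult.assoc)
  also have "\<dots> = cl (inverse s *\<^sub>p (var (U K') * (g * K_power c)))"
    using cl_cong(2)[OF comm', of "K_power c"] by (simp add: mult.assoc)
  also have "\<dots> = cl (inverse s *\<^sub>p (var (U K') * (s powi c *\<^sub>p (K_power c * g))))"
    by (intro cl_cong step2)
  also have "\<dots> = cl ((inverse s * s powi c) *\<^sub>p (K_power (c - 1) * g))"
    using cl_cong(3)[OF cl_cong(2)[OF K_power_diff_1[of c], of g], of "inverse s * s powi c"]
    by (simp add: mult.assoc)
  also have "inverse s * s powi c = s powi (c - 1)"
    using \<open>s \<noteq> 0\<close> by (simp add: power_int_diff field_simps)
  finally show ?case .
qed

lemma cl_E_X_power: "cl (var (U E) * var X ^ d) = cl (q ^ d *\<^sub>p (var X ^ d * var (U E)))"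
proof (induction d)
  case (Suc d)
  have "cl (var (U E) * var X ^ Suc d) = cl (q *\<^sub>p (var X * (var (U E) * var X ^ d)))"
    using cl_cong(2)[OF cl_osc(1), of "var X ^ d"] by (simp add: mult.assoc)
  also have "\<dots> = cl (q *\<^sub>p (var X * (q ^ d *\<^sub>p (var X ^ d * var (U E)))))"
    by (intro cl_cong Suc)
  finally show ?case
    by (simp add: mult.assoc)
qed simp

lemma cl_E_K: "cl (var (U E) * var (U K)) = cl (q_inv\<^sup>2 *\<^sub>p (var (U K) * var (U E)))"
  and cl_X_K: "cl (var X * var (U K)) = cl (q_inv *\<^sub>p (var (U K) * var X))"
  using cl_cong(3)[OF cl_K_commute(1), of "q_inv\<^sup>2"] cl_cong(3)[OF cl_K_commute(3), of q_inv]
  by (simp_all add: q_inv_def flip: power_mult_distrib)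

lemma intertwined_F_step:
  "intertwined opE (var (U E)) v \<Longrightarrow> intertwined opE (var (U E)) (opF v)"
  "intertwined opX (var X) v \<Longrightarrow> intertwined opX (var X) (opF v)"
proof -
  assume E: "intertwined opE (var (U E)) v"
  have "cl (to_free (opE (opF v)))
      = cl (var (U F) * to_free (opE v) + h_coeff *\<^sub>p (to_free (opK v) - to_free (opK' v)))"
    by (simp add: E_F opH_def to_free_opF)
  also have "\<dots> = cl (var (U F) * (var (U E) * to_free v)
      + h_coeff *\<^sub>p (var (U K) * to_free v - var (U K') * to_free v))"
    by (intro cl_cong cl_cong2 intertwinedD E intertwined_K intertwined_K')
  also have "\<dots> = cl (var (U E) * to_free (opF v))"
    using cl_cong(2)[OF cl_E_F, of "to_free v"]
    by (simp add: to_free_opF mult.assoc distrib_right left_diff_distrib)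
  finally show "intertwined opE (var (U E)) (opF v)"
    by (simp add: intertwined_def)
next
  assume X: "intertwined opX (var X) v"
  have "cl (to_free (opX (opF v))) = cl (var (U F) * to_free (opX v) - to_free (opY (opK' v)))"
    by (simp add: X_F to_free_opF)
  also have "\<dots> = cl (var (U F) * (var X * to_free v) - var Y * to_free (opK' v))"
    by (intro cl_cong cl_cong2 intertwinedD X intertwined_Y)
  also have "\<dots> = cl (var (U F) * var X * to_free v - var Y * (var (U K') * to_free v))"
    unfolding mult.assoc by (intro cl_cong cl_cong2 intertwinedD intertwined_K' refl)
  also have "\<dots> = cl ((var Y * var (U K') + var X * var (U F)) * to_free v
      - var Y * (var (U K') * to_free v))"
    by (intro cl_cong2 cl_cong cl_osc refl)
  also have "\<dots> = cl (var X * to_free (opF v))"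
    by (simp add: to_free_opF mult.assoc distrib_right)
  finally show "intertwined opX (var X) (opF v)"
    by (simp add: intertwined_def)
qed

lemma intertwined_E_X_base:
  "intertwined opE (var (U E)) (basis_vector (0, 0, c, d, e))"
  "intertwined opX (var X) (basis_vector (0, 0, c, d, e))"
proof -
  have "cl (var (U E) * K_power c * (var X ^ d * var (U E) ^ e))
      = cl (q_inv\<^sup>2 powi c *\<^sub>p (K_power c * var (U E)) * (var X ^ d * var (U E) ^ e))"
    by (intro cl_cong cl_mult_K_power cl_E_K) (simp add: q_inv_def)
  also have "\<dots> = cl (q_inv\<^sup>2 powi c *\<^sub>p (K_power c * (var (U E) * var X ^ d * var (U E) ^ e)))"
    by (simp add: mult.assoc)
  also have "\<dots> = cl (q_inv\<^sup>2 powi c *\<^sub>p (K_power c * (q ^ d *\<^sub>p (var X ^ d * var (U E)) * var (U E) ^ e)))"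
    by (intro cl_cong cl_E_X_power)
  also have "\<dots> = cl ((q_inv\<^sup>2 powi c * q ^ d) *\<^sub>p monomial (0, 0, c, d, Suc e))"
    by (simp add: monomial_def mult.assoc)
  also have "q_inv\<^sup>2 powi c * q ^ d = q powi (int d - 2 * c)"
    by (simp add: q_inv_def power_int_diff power_int_power power_inverse power_int_inverse field_simps)
  finally show "intertwined opE (var (U E)) (basis_vector (0, 0, c, d, e))"
    by (simp add: intertwined_def opE_def monomial_def mult.assoc)
  have "cl (var X * K_power c * (var X ^ d * var (U E) ^ e))
      = cl (q_inv powi c *\<^sub>p (K_power c * var X) * (var X ^ d * var (U E) ^ e))"
    by (intro cl_cong cl_mult_K_power cl_X_K) (simp add: q_inv_def)
  also have "\<dots> = cl (q powi (- c) *\<^sub>p monomial (0, 0, c, Suc d, e))"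
    by (simp add: monomial_def mult.assoc q_inv_def power_int_minus power_int_inverse)
  finally show "intertwined opX (var X) (basis_vector (0, 0, c, d, e))"
    by (simp add: intertwined_def X_seed_0 monomial_def mult.assoc)
qed

text \<open>The intertwining property passes from generators to polynomials on any invariant subspace. The
  renaming \<open>f\<close> allows the subalgebra generated by \<open>E\<close>, \<open>F\<close>, \<open>K\<close> to be treated on a piece of the
  filtration, where \<open>X\<close> and \<open>Y\<close> do not act.\<close>

lemma intertwined_act:
  assumes inv: "\<And>g v. Poly_Mapping.keys v \<subseteq> J \<Longrightarrow> Poly_Mapping.keys (T g v) \<subseteq> J"
    and gen: "\<And>g v. Poly_Mapping.keys v \<subseteq> J \<Longrightarrow> intertwined (T g) (var (f g)) v"
    and "Poly_Mapping.keys v \<subseteq> J"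
  shows "intertwined (act T p) (rename f p) v"
proof -
  have word: "cl (to_free (foldr T ws v)) = cl (basis_vector (Word (map f ws)) * to_free v)
      \<and> Poly_Mapping.keys (foldr T ws v) \<subseteq> J" for ws
  proof (induction ws)
    case Nil
    then show ?case
      using assms(3) by (simp flip: zero_free_monoid_def)
  next
    case (Cons g ws)
    have "cl (to_free (T g (foldr T ws v))) = cl (var (f g) * to_free (foldr T ws v))"
      using Cons by (intro intertwinedD gen) simp
    also have "\<dots> = cl (var (f g) * (basis_vector (Word (map f ws)) * to_free v))"
      using Cons by (intro cl_cong) simp
    also have "\<dots> = cl (basis_vector (Word (map f (g # ws))) * to_free v)"
      by (simp add: var_def mult_single plus_free_monoid_def flip: mult.assoc)
    finally show ?case
      using Cons inv by simp
  qed
  have "Poly_Mapping.keys p \<subseteq> UNIV" by simp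
  then show ?thesis
  proof (induction p rule: add_single_induct)
    case zero
    then show ?case by (simp add: intertwined_def rename_eq_linear_ext)
  next
    case (add p s)
    then show ?case
      using cl_cong2(1)[of "to_free (act T p v)" "rename f p * to_free v"
          "to_free (act T s v)" "rename f s * to_free v"]
      by (simp add: intertwined_def distrib_right)
  next
    case (single w c)
    have "act T (Poly_Mapping.single w c) v = c *\<^sub>p foldr T (letters w) v"
      by (simp add: act_def)
    moreover have "rename f (Poly_Mapping.single w c) = c *\<^sub>p basis_vector (Word (map f (letters w)))"
      by (cases w) (simp add: rename_eq_linear_ext)
    ultimately show ?case
      using cl_cong(3)[OF conjunct1[OF word]] by (simp add: intertwined_def)
  qed
qed

lemma linear_op_E: "linear_op opE" and linear_op_X: "linear_op opX"
  by (simp_all add: opE_def opX_def)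

lemma intertwined_uq:
  "intertwined opE (var (U E)) v \<Longrightarrow> intertwined (uq_op X_seed g) (var (U g)) v"
  using intertwined_F intertwined_K intertwined_K' by (cases g) (simp_all add: opE_def)

text \<open>The induction follows the construction of the operators: the values at exponent \<open>n + 1\<close> were defined from
  those at exponent \<open>n\<close> by relations that hold in the algebra, and $C_0$ is intertwined at
  exponent \<open>n\<close> because \<open>E\<close> is.\<close>

lemma intertwined_E_X_filt:
  "\<forall>v\<in>Y_filt n. intertwined opE (var (U E)) v \<and> intertwined opX (var X) v"
proof (induction n)
  case 0
  show ?case
  proof
    fix v :: "'k pbw_space" assume "v \<in> Y_filt 0"
    then show "intertwined opE (var (U E)) v \<and> intertwined opX (var X) v"
    proof (induction rule: Y_filt_induct)
      case (base b w)
      then show ?case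
        using intertwined_E_X_base by (cases w) simp
    qed (simp_all add: intertwined_linear linear_op_E linear_op_X intertwined_F_step)
  qed
next
  case (Suc n)
  have E: "intertwined opE (var (U E)) v" and X: "intertwined opX (var X) v" if "v \<in> Y_filt n" for v
    using Suc that by auto
  have C: "intertwined opC (rename U c0) v" if "v \<in> Y_filt n" for v
    unfolding opC_def using that uq_op_filt[OF X_seed_filt, of _ n] intertwined_uq[OF E]
    by (intro intertwined_act[where J = "{(a, b, w). b \<le> n}"]) (simp_all add: Y_filt_def)
  have Y: "intertwined opE (var (U E)) (opY v) \<and> intertwined opX (var X) (opY v)"
    if v: "v \<in> Y_filt n" "v = basis_vector (0, n, w)" for v w
  proof
    have "cl (to_free (opE (opY v))) = cl (to_free (opX v) + q_inv *\<^sub>p to_free (opY (opE v)))"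
      by (simp add: E_Y)
    also have "\<dots> = cl (var X * to_free v + q_inv *\<^sub>p (var Y * to_free (opE v)))"
      by (intro cl_cong cl_cong2 intertwinedD intertwined_Y X v)
    also have "\<dots> = cl (var X * to_free v + q_inv *\<^sub>p (var Y * (var (U E) * to_free v)))"
      by (intro cl_cong cl_cong2 intertwinedD E v refl)
    also have "\<dots> = cl (var (U E) * (var Y * to_free v))"
      using cl_cong(2)[OF cl_osc(2), of "to_free v"] by (simp add: mult.assoc distrib_right)
    also have "\<dots> = cl (var (U E) * to_free (opY v))"
      by (intro cl_cong intertwinedD[symmetric] intertwined_Y)
    finally show "intertwined opE (var (U E)) (opY v)"
      by (simp add: intertwined_def)
    have "cl (to_free (opX (opY v))) = cl (q *\<^sub>p to_free (opY (opX v)) - to_free (opC v))"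
      by (simp add: v X_seed_Suc)
    also have "\<dots> = cl (q *\<^sub>p (var Y * to_free (opX v)) - rename U c0 * to_free v)"
      by (intro cl_cong cl_cong2 intertwinedD intertwined_Y C v)
    also have "\<dots> = cl (q *\<^sub>p (var Y * (var X * to_free v)) - rename U c0 * to_free v)"
      by (intro cl_cong cl_cong2 intertwinedD X v refl)
    also have "\<dots> = cl (var X * (var Y * to_free v))"
      using cl_cong(2)[OF cl_osc(5), of "to_free v"] by (simp add: mult.assoc left_diff_distrib)
    also have "\<dots> = cl (var X * to_free (opY v))"
      by (intro cl_cong intertwinedD[symmetric] intertwined_Y)
    finally show "intertwined opX (var X) (opY v)"
      by (simp add: intertwined_def)
  qed
  show ?case
  proof
    fix v :: "'k pbw_space" assume "v \<in> Y_filt (Suc n)"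
    then show "intertwined opE (var (U E)) v \<and> intertwined opX (var X) v"
    proof (induction rule: Y_filt_induct)
      case (base b w)
      then show ?case
        using Y[of "basis_vector (0, n, w)" w] E[of "basis_vector (0, b, w)"] X[of "basis_vector (0, b, w)"]
        by (cases "b = Suc n") auto
    qed (simp_all add: intertwined_linear linear_op_E linear_op_X intertwined_F_step)
  qed
qed

lemma intertwined_osc_op: "intertwined (osc_op g) (var g) v"
proof -
  have "intertwined opE (var (U E)) v" "intertwined opX (var X) v"
    using ex_filt intertwined_E_X_filt by blast+
  then show ?thesis
    using intertwined_uq intertwined_Y by (cases g) simp_all
qed

definition cyclic_vector :: "'k pbw_space"
  where "cyclic_vector = basis_vector (0, 0, 0, 0, 0)"

text \<open>The vector \<open>1\<close> is mapped to the unit of the algebra, so \<open>p \<cdot> 1\<close> is mapped to the class of \<open>p\<close>.\<close>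

lemma cl_to_free_act: "cl (to_free (act osc_op p cyclic_vector)) = cl p"
proof -
  have "Poly_Mapping.keys p \<subseteq> UNIV"
    by simp
  then have "rename id p = p"
    by (induction p rule: add_single_induct)
      (simp_all add: rename_eq_linear_ext free_monoid.map_ident id_def scale_single)
  moreover have "intertwined (act osc_op p) (rename id p) cyclic_vector"
    by (rule intertwined_act[where J = UNIV]) (simp_all add: intertwined_osc_op)
  moreover have "to_free cyclic_vector = 1"
    by (simp add: cyclic_vector_def monomial_def K_power_def)
  ultimately show ?thesis
    by (simp add: intertwined_def)
qed

text \<open>Applied to \<open>1\<close> from right to left, each factor of the monomial acts as a plain shift: the powers
  of \<open>q\<close> and the correction terms in its operator come from generators that stand to the left of it
  in the monomial, and these are not yet present.\<close>

lemma act_monomial: "act osc_op (monomial i) cyclic_vector = basis_vector i"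
proof -
  obtain a b c d e where i: "i = (a, b, c, d, e)"
    by (cases i)
  have power: "act osc_op (var g ^ n) v = (osc_op g ^^ n) v" for g n v
    by (induction n) (simp_all add: act_mult[OF linear_op_osc_op])
  have E: "(uq_op X_seed E ^^ n) cyclic_vector = basis_vector (0, 0, 0, 0, n)" for n
    by (induction n) (simp_all add: cyclic_vector_def)
  have X: "(opX ^^ n) (basis_vector (0, 0, 0, 0, e)) = basis_vector (0, 0, 0, n, e)" for n
    by (induction n) (simp_all add: X_seed_0)
  have K: "(opK ^^ n) (basis_vector (0, 0, 0, d, e)) = basis_vector (0, 0, int n, d, e)"
    "(opK' ^^ n) (basis_vector (0, 0, 0, d, e)) = basis_vector (0, 0, - int n, d, e)" for n
    by (induction n) (simp_all add: add.commute minus_diff_commute)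
  have Y: "(opY ^^ n) (basis_vector (0, 0, c, d, e)) = basis_vector (0, n, c, d, e)" for n
    by (induction n) simp_all
  have F: "(opF ^^ n) (basis_vector (0, b, c, d, e)) = basis_vector (n, b, c, d, e)" for n
    by (induction n) simp_all
  have "act osc_op (K_power c) (basis_vector (0, 0, 0, d, e)) = basis_vector (0, 0, c, d, e)"
    by (simp add: K_power_def power K)
  then show ?thesis
    by (simp add: i monomial_def act_mult[OF linear_op_osc_op] power E X Y F del: uq_op.simps(1))
qed

lemma cl_mult: "cl p \<otimes>\<^bsub>osc_algebra q c0\<^esub> cl s = cl (p * s)"
  and cl_one: "\<one>\<^bsub>osc_algebra q c0\<^esub> = cl 1"
  by (simp_all add: cl_def osc_algebra_def presented_algebra_sel)

text \<open>The integer power in \<open>pbw_monomial\<close> uses the inverse in the algebra, which for a power of \<open>K\<close> is the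
  class of the same power of \<open>K'\<close>.\<close>

lemma pbw_monomial_eq: "pbw_monomial q c0 i = cl (monomial i)"
proof -
  interpret ring "osc_algebra q c0"
    unfolding osc_algebra_def by (rule ring_presented_algebra)
  have carrier: "cl p \<in> carrier (osc_algebra q c0)" for p
    by (simp add: cl_def osc_algebra_def presented_algebra_sel)
  have power: "cl p [^]\<^bsub>osc_algebra q c0\<^esub> (n :: nat) = cl (p ^ n)" for p n
    by (induction n) (simp_all add: cl_mult cl_one power_commutes)
  have inverse: "cl (var (U K) ^ n * var (U K') ^ n) = cl 1"
    "cl (var (U K') ^ n * var (U K) ^ n) = cl 1" for n
  proof (induction n)
    case (Suc n)
    have "cl (var g ^ Suc n * var g' ^ Suc n) = cl 1"
      if "cl (var g * var g') = cl 1" "cl (var g ^ n * var g' ^ n) = cl 1" for g g'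
    proof -
      have "cl (var g ^ Suc n * var g' ^ Suc n) = cl (var g * (var g ^ n * var g' ^ n) * var g')"
        by (simp add: mult.assoc power_commutes)
      also have "\<dots> = cl (var g * 1 * var g')"
        by (intro cl_cong that)
      finally show ?thesis
        using that by simp
    qed
    from this[OF cl_K_K'(1) Suc(1)] this[OF cl_K_K'(2) Suc(2)]
    show "cl (var (U K) ^ Suc n * var (U K') ^ Suc n) = cl 1"
      "cl (var (U K') ^ Suc n * var (U K) ^ Suc n) = cl 1" by auto
  qed simp_all
  have "inv\<^bsub>osc_algebra q c0\<^esub> cl (var (U K) ^ n) = cl (var (U K') ^ n)" for n
    using inv_unique'[of "cl (var (U K) ^ n)" "cl (var (U K') ^ n)"] carrier inverse[of n]
    by (simp add: cl_mult cl_one)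
  then have int_power: "cl (var (U K)) [^]\<^bsub>osc_algebra q c0\<^esub> c = cl (K_power c)" for c :: int
    by (simp add: int_pow_def2 power K_power_def)
  have elem: "osc_elem q c0 g = cl (var g)" for g
    by (simp add: osc_elem_def cl_def)
  show ?thesis
    by (cases i) (simp add: pbw_monomial_def elem power int_power monomial_def cl_mult mult.assoc Let_def)
qed

end

section \<open>The PBW basis\<close>

context central_osc_construction
begin

lemma osc_relators_act_by_zero:
  assumes "\<rho> \<in> osc_relators q c0"
  shows "act osc_op \<rho> v = 0"
proof -
  obtain n where "v \<in> Y_filt n"
    using ex_filt by blast
  then have "act osc_op (rename U \<rho>') v = 0" if "\<rho>' \<in> uq_relators q" for \<rho>'
    using uq_relators_act_by_zero[OF K_E that] by (simp add: act_rename)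
  moreover have "act osc_op (rename U c0) v = opC v"
    by (simp add: act_rename opC_def)
  ultimately show ?thesis
    using assms
    by (auto simp: osc_relators_def act_mult[OF linear_op_osc_op] uq_op_X_seed E_X E_Y X_F Y_F X_Y
        K_X K_Y q_inv_def simp del: uq_op.simps(1))
qed

lemma act_to_free: "act osc_op (to_free v) cyclic_vector = v"
  by (induction v rule: unit_induct) (simp_all add: act_monomial)

text \<open>A polynomial in the relation ideal acts by zero, whereas the lift of \<open>v\<close> sends \<open>1\<close> to \<open>v\<close>.\<close>

lemma to_free_inj: "cl (to_free v) = cl 0 \<Longrightarrow> v = 0"
proof -
  assume "cl (to_free v) = cl 0"
  then have "to_free v \<in> relation_ideal (osc_relators q c0)"
    by (simp add: cl_def coset_of_eq_iff)
  then have "act osc_op (to_free v) cyclic_vector = 0"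
    by (rule relation_ideal_acts_by_zero[OF linear_op_osc_op, where J = UNIV, rotated 2])
      (simp_all add: osc_relators_act_by_zero)
  then show "v = 0"
    by (simp add: act_to_free)
qed

lemma pbw_basis:
  "inj (pbw_monomial q c0) \<and>
    vectorspace.basis class_ring (osc_algebra q c0) (range (pbw_monomial q c0))"
proof -
  have "pbw_monomial q c0 = (\<lambda>i. coset_of (osc_relators q c0) (monomial i))"
    by (rule ext) (simp add: pbw_monomial_eq cl_def)
  moreover have "\<exists>v. coset_of (osc_relators q c0) p
      = coset_of (osc_relators q c0) (linear_ext monomial v)" for p
    using cl_to_free_act[of p] by (auto simp: cl_def to_free_def intro: sym)
  ultimately show ?thesis
    unfolding osc_algebra_def
    using basis_of_linear_bijection[of "osc_relators q c0" monomial] to_free_inj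
    by (simp add: cl_def to_free_def)
qed

end

theorem theorem2p1:
  fixes q :: "'k::field"
    and C0 :: "(uq_gen, 'k) ncpoly set"
    and c0 :: "(uq_gen, 'k) ncpoly"
  assumes "CHAR('k) \<noteq> 2"
    and "q \<noteq> 0" and "q\<^sup>2 \<noteq> 1"
    and "C0 \<in> center (uq_sl2 q)"
    and "c0 \<in> C0"
  shows "inj (pbw_monomial q c0) \<and>
    vectorspace.basis class_ring (osc_algebra q c0) (range (pbw_monomial q c0))"
proof -
  interpret central_osc_construction q c0
    using assms center_representative_commutes[of C0 "uq_relators q" c0]
    by unfold_locales (auto simp: uq_sl2_def)
  show ?thesis
    by (rule pbw_basis)
qed

end
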